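(* Let $\eta$ be a Poisson process on a measurable space $(\mathbb{X},\mathcal{X})$ with $\sigma$-finite intensity measure $\lambda$. Let $F=F(\eta)$ be a square-integrable Poisson functional satisfying $$\mathbb{E}\left[\int (D_{x,y}^2F)^2\,\mathrm{d}\lambda^2(x,y)\right]\leq\alpha\, \mathbb{E}\left[\int (D_{x}F)^2 \,\mathrm{d}\lambda(x)\right]<\infty$$ for some constant $\alpha\geq 0$. Then $$\mathrm{Var}[F]\geq\frac{4}{(\alpha+2)^2}\,\mathbb{E}\left[\int (D_{x}F)^2 \,\mathrm{d}\lambda(x)\right].$$
   Context: Let $\mathbf{N}$ be the set of all $\sigma$-finite counting measures on $(\mathbb{X},\mathcal{X})$, equipped with the $\sigma$-field generated by the mappings $\nu\mapsto\nu(B)$, $B\in\mathcal{X}$. The Poisson process $\eta$ is a random element of $\mathbf{N}$. A Poisson functional is a real-valued random variable $F$ of the form $F=f(\eta)$ with $f:\mathbf{N}\to\mathbb{R}$ measurable (a representative); by abuse of notation one writes $F=F(\eta)$ for $f(\eta)$ and $F(\eta+\delta_x)$ for $f(\eta+\delta_x)$, etc. Here $\delta_x$ is the Dirac measure at $x$. For $x,y\in\mathbb{X}$ the difference operators are $$D_xF=F(\eta+\delta_x)-F(\eta),$$ $$D^2_{x,y}F=D_x(D_yF)=F(\eta+\delta_x+\delta_y)-F(\eta+\delta_x)-F(\eta+\delta_y)+F(\eta).$$ *)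

theory Defs
  imports "HOL-Probability.Probability"
begin

text \<open>
  A measurable space is represented by a measure \<open>M\<close> of which only \<open>space M\<close> and \<open>sets M\<close> matter.
  In the applications below, \<open>M\<close> is the intensity measure.
\<close>

definition counting_measures :: "'a measure \<Rightarrow> 'a measure set" where
  "counting_measures M = {\<nu>. sets \<nu> = sets M \<and> sigma_finite_measure \<nu> \<and>
     (\<forall>B\<in>sets M. emeasure \<nu> B \<in> range ennreal_of_enat)}"

text \<open>The \<open>\<sigma>\<close>-field generated by the evaluations \<open>\<nu> \<mapsto> \<nu>(B)\<close>, built as in \<^const>\<open>subprob_algebra\<close>.\<close>

definition counting_algebra :: "'a measure \<Rightarrow> 'a measure measure" where
  "counting_algebra M =
     (SUP B\<in>sets M. vimage_algebra (counting_measures M) (\<lambda>\<nu>. emeasure \<nu> B) borel)"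

text \<open>
  A Poisson process \<open>\<eta>\<close> with intensity measure \<open>L\<close>, defined on the probability space \<open>P\<close>.
  For \<open>L(B) = 0\<close> the formula in \<open>poisson_finite\<close> is the point mass at \<open>0\<close>
  (as \<open>0 ^ 0 = 1\<close>), and the Poisson distribution with parameter \<open>\<infinity>\<close> is the point mass at \<open>\<infinity>\<close>.
  The \<open>\<sigma>\<close>-finiteness of \<open>L\<close> is not part of the definition.
\<close>

locale poisson_process = prob_space P for P :: "'w measure" +
  fixes L :: "'a measure" and \<eta> :: "'w \<Rightarrow> 'a measure"
  assumes random_element: "\<eta> \<in> P \<rightarrow>\<^sub>M counting_algebra L"
    and poisson_finite: "\<And>B k. B \<in> sets L \<Longrightarrow> emeasure L B < \<infinity> \<Longrightarrow>
      prob {\<omega> \<in> space P. emeasure (\<eta> \<omega>) B = of_nat k} =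
        measure L B ^ k / fact k * exp (- measure L B)"
    and poisson_infinite: "\<And>B. B \<in> sets L \<Longrightarrow> emeasure L B = \<infinity> \<Longrightarrow>
      AE \<omega> in P. emeasure (\<eta> \<omega>) B = \<infinity>"
    and independent: "\<And>(m :: nat) B. (\<And>i. i < m \<Longrightarrow> B i \<in> sets L) \<Longrightarrow>
      disjoint_family_on B {..<m} \<Longrightarrow>
      indep_vars (\<lambda>_. borel) (\<lambda>i \<omega>. emeasure (\<eta> \<omega>) (B i)) {..<m}"

definition add_measure :: "'a measure \<Rightarrow> 'a measure \<Rightarrow> 'a measure" where
  "add_measure \<mu> \<nu> = measure_of (space \<mu>) (sets \<mu>) (\<lambda>B. emeasure \<mu> B + emeasure \<nu> B)"

text \<open>\<^term>\<open>return \<nu> x\<close> is the Dirac measure at \<open>x\<close> on the measurable space underlying \<open>\<nu>\<close>.\<close>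

definition add_point :: "'a measure \<Rightarrow> 'a \<Rightarrow> 'a measure" where
  "add_point \<nu> x = add_measure \<nu> (return \<nu> x)"

definition diff_op :: "'a \<Rightarrow> ('a measure \<Rightarrow> real) \<Rightarrow> 'a measure \<Rightarrow> real" where
  "diff_op x F = (\<lambda>\<nu>. F (add_point \<nu> x) - F \<nu>)"

definition diff_op2 :: "'a \<Rightarrow> 'a \<Rightarrow> ('a measure \<Rightarrow> real) \<Rightarrow> 'a measure \<Rightarrow> real" where
  "diff_op2 x y F = diff_op x (diff_op y F)"

text \<open>
  The constructions \<^const>\<open>measure_of\<close> and \<open>SUP\<close> return junk on unsuitable arguments;
  the following facts show that this does not happen here.
\<close>

lemma sets_add_measure [simp]: "sets (add_measure \<mu> \<nu>) = sets \<mu>"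
  by (simp add: add_measure_def)

lemma emeasure_add_measure:
  assumes "sets \<nu> = sets \<mu>" "B \<in> sets \<mu>"
  shows "emeasure (add_measure \<mu> \<nu>) B = emeasure \<mu> B + emeasure \<nu> B"
proof (rule emeasure_measure_of[OF add_measure_def])
  show "sets \<mu> \<subseteq> Pow (space \<mu>)" by (rule sets.space_closed)
  show "positive (sets (add_measure \<mu> \<nu>)) (\<lambda>B. emeasure \<mu> B + emeasure \<nu> B)"
    by (simp add: positive_def)
  show "countably_additive (sets (add_measure \<mu> \<nu>)) (\<lambda>B. emeasure \<mu> B + emeasure \<nu> B)"
    using assms(1)
    by (auto simp: countably_additive_def suminf_add[symmetric] suminf_emeasure)
qed (use assms in simp)

lemma sets_add_point [simp]: "sets (add_point \<nu> x) = sets \<nu>"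
  by (simp add: add_point_def)

lemma emeasure_add_point:
  "B \<in> sets \<nu> \<Longrightarrow> emeasure (add_point \<nu> x) B = emeasure \<nu> B + indicator B x"
  by (simp add: add_point_def emeasure_add_measure)

lemma add_point_counting_measures:
  assumes "\<nu> \<in> counting_measures M"
  shows "add_point \<nu> x \<in> counting_measures M"
proof -
  have s: "sets \<nu> = sets M" and sf: "sigma_finite_measure \<nu>"
    and r: "\<And>B. B \<in> sets M \<Longrightarrow> emeasure \<nu> B \<in> range ennreal_of_enat"
    using assms by (auto simp: counting_measures_def)
  have sp: "space (add_point \<nu> x) = space \<nu>" by (rule sets_eq_imp_space_eq) simp
  obtain A where A: "countable A" "A \<subseteq> sets \<nu>" "\<Union>A = space \<nu>" "\<forall>a\<in>A. emeasure \<nu> a \<noteq> \<infinity>"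
    using sigma_finite_measure.sigma_finite_countable[OF sf] by auto
  have "sigma_finite_measure (add_point \<nu> x)"
    by standard (rule exI[of _ A], use A in \<open>auto simp: sp emeasure_add_point indicator_def subset_iff\<close>)
  moreover have "emeasure (add_point \<nu> x) B \<in> range ennreal_of_enat" if B: "B \<in> sets M" for B
  proof -
    obtain n where n: "emeasure \<nu> B = ennreal_of_enat n" using r[OF B] by auto
    have "emeasure (add_point \<nu> x) B = ennreal_of_enat (n + indicator B x)"
      using B s n by (cases n) (auto simp: emeasure_add_point indicator_def one_enat_def)
    then show ?thesis by blast
  qed
  ultimately show ?thesis using s by (auto simp: counting_measures_def)
qed

lemma diff_op2_eq:
  "diff_op2 x y F \<nu> =
     F (add_point (add_point \<nu> x) y) - F (add_point \<nu> x) - F (add_point \<nu> y) + F \<nu>"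
  by (simp add: diff_op2_def diff_op_def)

lemma add_point_commute: "add_point (add_point \<nu> x) y = add_point (add_point \<nu> y) x"
  by (rule measure_eqI) (auto simp: emeasure_add_point ac_simps)

lemma space_counting_algebra: "space (counting_algebra M) = counting_measures M"
  by (auto simp: counting_algebra_def space_Sup_eq_UN)

lemma measurable_emeasure_counting_algebra:
  assumes "B \<in> sets M"
  shows "(\<lambda>\<nu>. emeasure \<nu> B) \<in> counting_algebra M \<rightarrow>\<^sub>M borel"
  unfolding counting_algebra_def
  by (rule measurable_SUP1[OF assms measurable_vimage_algebra1]) auto

end

(*
  Integration by parts (the Mecke formula) gives E[F delta(u)] = E[int D_xF u_x dL(x)] for the
  Kabanov-Skorohod integral delta(u) = int u_x(eta - delta_x) eta(dx) - int u_x L(dx), and applied twice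
  E[delta(u)^2] = E[int u_x^2] + E[int int D_yu_x D_xu_y] <= E[int u_x^2] + E[int int (D_yu_x)^2].
  Expanding E[(F - E F - t delta(u))^2] >= 0 yields
  Var F >= 2t E[int D_xF u_x] - t^2 (E[int u_x^2] + E[int int (D_yu_x)^2]).
  Take for u_x the truncation of D_xF to [-k, k], restricted to a set of finite intensity. Then all
  integrals exist; since truncation is 1-Lipschitz, (D_yu_x)^2 <= (D^2_{x,y}F)^2, and D_xF u_x >= u_x^2.
  Monotone convergence gives (2t - t^2) E[int (D_xF)^2] <= Var F + t^2 E[int int (D^2_{x,y}F)^2],
  and t = 2/(alpha + 2) makes the coefficients match.
*)

theory Submission
  imports Defs
begin

subsection \<open>Integration by parts under an abstract Mecke formula\<close>

text \<open>Two choices follow from this. Integrands are written as functions \<open>w\<close> of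
  the pair (configuration with the point, point), so that no point is ever subtracted. The Mecke
  formula is derived from the joint law of the counts of disjoint sets alone: there it is the
  recursion k p(k) = l p(k - 1) of the Poisson weights, and a uniqueness theorem for measures on
  configurations extends it to all events. The set of finite intensity confines only the integrals
  over points; F is always evaluated at the whole configuration, so F itself is never approximated.
  The number of points in that set has a finite second moment, which makes the pathwise integral
  \<open>delta\<close> of a bounded integrand square integrable.\<close>

lemma integrable_mult_of_squares:
  fixes f g :: "'b \<Rightarrow> real"
  assumes [measurable]: "f \<in> borel_measurable M" "g \<in> borel_measurable M"
    and "integrable M (\<lambda>x. (f x)\<^sup>2)" "integrable M (\<lambda>x. (g x)\<^sup>2)"
  shows "integrable M (\<lambda>x. f x * g x)"
proof (rule Bochner_Integration.integrable_bound)
  show "integrable M (\<lambda>x. (f x)\<^sup>2 + (g x)\<^sup>2)"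
    using assms by simp
  have "\<bar>a * b\<bar> \<le> a\<^sup>2 + b\<^sup>2" for a b :: real
  proof -
    have "0 \<le> (\<bar>a\<bar> - \<bar>b\<bar>)\<^sup>2" "0 \<le> \<bar>a\<bar> * \<bar>b\<bar>" by simp_all
    then show ?thesis
      unfolding power2_diff abs_mult power2_abs by linarith
  qed
  then show "AE x in M. norm (f x * g x) \<le> norm ((f x)\<^sup>2 + (g x)\<^sup>2)"
    by simp
qed simp

text \<open>
  A point \<open>v\<close> of the probability space \<open>Q\<close> stands for a configuration, \<open>K v\<close> for its counting measure,
  of finite intensity \<open>R\<close>, and \<open>add v x\<close> for the configuration with the point \<open>x\<close> added.
\<close>

locale mecke_space = Q: prob_space Q + R: finite_measure R
  for Q :: "'n measure" and R :: "'a measure" +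
  fixes K :: "'n \<Rightarrow> 'a measure" and add :: "'n \<Rightarrow> 'a \<Rightarrow> 'n"
  assumes add_measurable: "(\<lambda>p. add (fst p) (snd p)) \<in> Q \<Otimes>\<^sub>M R \<rightarrow>\<^sub>M Q"
    and add_commute: "\<And>v x y. add (add v x) y = add (add v y) x"
    and sets_K: "\<And>v. v \<in> space Q \<Longrightarrow> sets (K v) = sets R"
    and finite_K: "\<And>v. v \<in> space Q \<Longrightarrow> finite_measure (K v)"
    and nn_integral_K_measurable: "\<And>h. h \<in> borel_measurable (Q \<Otimes>\<^sub>M R) \<Longrightarrow>
      (\<lambda>v. \<integral>\<^sup>+x. h (v, x) \<partial>K v) \<in> borel_measurable Q"
    and mecke: "\<And>h. h \<in> borel_measurable (Q \<Otimes>\<^sub>M R) \<Longrightarrow>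
      (\<integral>\<^sup>+v. (\<integral>\<^sup>+x. h (v, x) \<partial>K v) \<partial>Q) = (\<integral>\<^sup>+p. h (add (fst p) (snd p), snd p) \<partial>(Q \<Otimes>\<^sub>M R))"
    and nn_integral_K_add: "AE p in Q \<Otimes>\<^sub>M R. \<forall>f \<in> borel_measurable R.
      (\<integral>\<^sup>+y. f y \<partial>K (add (fst p) (snd p))) = f (snd p) + (\<integral>\<^sup>+y. f y \<partial>K (fst p))"
begin

sublocale QR: pair_sigma_finite Q R
  by unfold_locales

sublocale QR: finite_measure "Q \<Otimes>\<^sub>M R"
  by (rule finite_measure_pair_measure) unfold_locales

lemma add_measurable' [measurable (raw)]:
  assumes "f \<in> M \<rightarrow>\<^sub>M Q" "g \<in> M \<rightarrow>\<^sub>M R"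
  shows "(\<lambda>x. add (f x) (g x)) \<in> M \<rightarrow>\<^sub>M Q"
  using measurable_compose[OF measurable_Pair[OF assms] add_measurable] by simp

lemma space_K: "v \<in> space Q \<Longrightarrow> space (K v) = space R"
  by (rule sets_eq_imp_space_eq[OF sets_K])

lemma measurable_K: "v \<in> space Q \<Longrightarrow> measurable (K v) M = measurable R M"
  by (rule measurable_cong_sets[OF sets_K refl])

lemma add_in_space: "v \<in> space Q \<Longrightarrow> x \<in> space R \<Longrightarrow> add v x \<in> space Q"
  using measurable_space[OF add_measurable, of "(v, x)"] by (simp add: space_pair_measure)

section \<open>Moments of the number of points\<close>

definition mass :: "'n \<Rightarrow> real" where
  "mass v = measure (K v) (space R)"

lemma ennreal_mass: "v \<in> space Q \<Longrightarrow> ennreal (mass v) = (\<integral>\<^sup>+x. 1 \<partial>K v)"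
  using finite_measure.emeasure_eq_measure[OF finite_K] by (simp add: mass_def space_K)

lemma mass_nonneg: "0 \<le> mass v"
  by (simp add: mass_def)

lemma mass_measurable [measurable]: "mass \<in> borel_measurable Q"
proof -
  have "(\<lambda>v. enn2real (\<integral>\<^sup>+x. 1 \<partial>K v)) \<in> borel_measurable Q"
    using nn_integral_K_measurable[of "\<lambda>_. 1"] by simp
  then show ?thesis
    by (rule measurable_cong[THEN iffD1, rotated])
      (metis ennreal_mass enn2real_ennreal mass_nonneg)
qed

lemma mass_add: "AE p in Q \<Otimes>\<^sub>M R. mass (add (fst p) (snd p)) = mass (fst p) + 1"
  using nn_integral_K_add AE_space
proof eventually_elim
  case (elim p)
  have "fst p \<in> space Q" "add (fst p) (snd p) \<in> space Q"
    using elim(2) by (auto simp: space_pair_measure add_in_space)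
  moreover have "(\<integral>\<^sup>+y. 1 \<partial>K (add (fst p) (snd p))) = 1 + (\<integral>\<^sup>+y. 1 \<partial>K (fst p))"
    using bspec[OF elim(1), of "\<lambda>_. 1"] by simp
  ultimately have "ennreal (mass (add (fst p) (snd p))) = ennreal (mass (fst p) + 1)"
    by (simp only: ennreal_mass ennreal_plus mass_nonneg ennreal_1 zero_le_one add.commute)
  then show ?case
    by (subst (asm) ennreal_inj) (auto simp: mass_nonneg)
qed

text \<open>The Mecke formula for an integrand that ignores the point: weighting by the number of
  points amounts to adding one.\<close>

lemma nn_integral_mult_mass:
  assumes [measurable]: "f \<in> borel_measurable Q"
  shows "(\<integral>\<^sup>+v. f v * ennreal (mass v) \<partial>Q) = (\<integral>\<^sup>+p. f (add (fst p) (snd p)) \<partial>(Q \<Otimes>\<^sub>M R))"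
proof -
  have "(\<integral>\<^sup>+v. f v * ennreal (mass v) \<partial>Q) = (\<integral>\<^sup>+v. (\<integral>\<^sup>+x. f (fst (v, x)) \<partial>K v) \<partial>Q)"
    by (intro nn_integral_cong) (simp add: ennreal_mass)
  also have "\<dots> = (\<integral>\<^sup>+p. f (add (fst p) (snd p)) \<partial>(Q \<Otimes>\<^sub>M R))"
    by (subst mecke) simp_all
  finally show ?thesis .
qed

lemma integrable_mass: "integrable Q mass"
proof (rule integrableI_nonneg)
  show "(\<integral>\<^sup>+v. ennreal (mass v) \<partial>Q) < \<infinity>"
    using nn_integral_mult_mass[of "\<lambda>_. 1"] by (simp add: less_top[symmetric])
qed (auto simp: mass_nonneg)

text \<open>Weighting by \<open>mass\<close> once more turns the second moment into the integral of
  \<open>mass\<close> after a point has been added, that is of \<open>mass + 1\<close>, so the first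
  moment controls it.\<close>

lemma integrable_mass_square: "integrable Q (\<lambda>v. (mass v)\<^sup>2)"
proof (rule integrableI_nonneg)
  have fin: "(\<integral>\<^sup>+p. ennreal (mass (fst p)) \<partial>(Q \<Otimes>\<^sub>M R)) < \<infinity>"
  proof -
    have "(\<integral>\<^sup>+p. ennreal (mass (fst p)) \<partial>(Q \<Otimes>\<^sub>M R)) = (\<integral>\<^sup>+v. ennreal (mass v) * emeasure R (space R) \<partial>Q)"
      by (subst R.nn_integral_fst[symmetric]) auto
    also have "\<dots> = (\<integral>\<^sup>+v. ennreal (mass v) \<partial>Q) * emeasure R (space R)"
      by (rule nn_integral_multc) simp
    also have "(\<integral>\<^sup>+v. ennreal (mass v) \<partial>Q) = ennreal (\<integral>v. mass v \<partial>Q)"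
      by (rule nn_integral_eq_integral[OF integrable_mass]) (simp add: mass_nonneg)
    finally show ?thesis
      using R.emeasure_finite[of "space R"] by (simp add: ennreal_mult_eq_top_iff less_top[symmetric])
  qed
  have "(\<integral>\<^sup>+v. ennreal ((mass v)\<^sup>2) \<partial>Q) = (\<integral>\<^sup>+v. ennreal (mass v) * ennreal (mass v) \<partial>Q)"
    by (simp add: ennreal_mult'[symmetric] mass_nonneg power2_eq_square)
  also have "\<dots> = (\<integral>\<^sup>+p. ennreal (mass (add (fst p) (snd p))) \<partial>(Q \<Otimes>\<^sub>M R))"
    by (rule nn_integral_mult_mass) simp
  also have "\<dots> = (\<integral>\<^sup>+p. ennreal (mass (fst p)) + 1 \<partial>(Q \<Otimes>\<^sub>M R))"
    using mass_add
    by (intro nn_integral_cong_AE) (auto elim!: eventually_mono simp: mass_nonneg)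
  also have "\<dots> = (\<integral>\<^sup>+p. ennreal (mass (fst p)) \<partial>(Q \<Otimes>\<^sub>M R)) + emeasure (Q \<Otimes>\<^sub>M R) (space (Q \<Otimes>\<^sub>M R))"
    by (subst nn_integral_add) auto
  also have "\<dots> < \<infinity>"
    using fin by (simp add: less_top[symmetric])
  finally show "(\<integral>\<^sup>+v. ennreal ((mass v)\<^sup>2) \<partial>Q) < \<infinity>" .
qed auto

text \<open>The positive and the negative part of \<open>h\<close> are treated separately by
  \<open>mecke\<close>; the integrability assumption makes both sides finite, so that they may be
  subtracted.\<close>

lemma mecke_integral:
  fixes h :: "'n \<times> 'a \<Rightarrow> real"
  assumes [measurable]: "h \<in> borel_measurable (Q \<Otimes>\<^sub>M R)"
    and int: "integrable (Q \<Otimes>\<^sub>M R) (\<lambda>p. h (add (fst p) (snd p), snd p))"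
  shows "AE v in Q. integrable (K v) (\<lambda>x. h (v, x))"
    and "integrable Q (\<lambda>v. \<integral>x. h (v, x) \<partial>K v)"
    and "(\<integral>v. (\<integral>x. h (v, x) \<partial>K v) \<partial>Q) = (\<integral>p. h (add (fst p) (snd p), snd p) \<partial>(Q \<Otimes>\<^sub>M R))"
proof -
  \<comment> \<open>\<open>ennreal\<close> sends negative numbers to 0, so \<open>a 1\<close> and
    \<open>a (-1)\<close> integrate the positive and the negative part.\<close>
  define a where "a s v = (\<integral>\<^sup>+x. ennreal (s * h (v, x)) \<partial>K v)" for s v
  have a_meas [measurable]: "a s \<in> borel_measurable Q" for s
    unfolding a_def by (rule nn_integral_K_measurable) simp
  have a_int: "(\<integral>\<^sup>+v. a s v \<partial>Q) = (\<integral>\<^sup>+p. ennreal (s * h (add (fst p) (snd p), snd p)) \<partial>(Q \<Otimes>\<^sub>M R))" for s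
    unfolding a_def by (rule mecke) simp
  have a_fin: "(\<integral>\<^sup>+v. a s v \<partial>Q) < \<infinity>" for s
    unfolding a_int using real_integrable_def[THEN iffD1, OF integrable_mult_right[OF int, of s]]
    by (simp add: less_top[symmetric])
  have a_AE: "AE v in Q. a s v < \<infinity>" for s
    using nn_integral_PInf_AE[OF a_meas[of s]] a_fin[of s] by (auto simp: less_top)
  have h_meas: "(\<lambda>x. h (v, x)) \<in> borel_measurable (K v)" if "v \<in> space Q" for v
    using that by (simp add: measurable_K)
  show AE_int: "AE v in Q. integrable (K v) (\<lambda>x. h (v, x))"
    using a_AE[of 1] a_AE[of "-1"] AE_space
    by eventually_elim (auto simp: real_integrable_def a_def h_meas)
  have eq: "AE v in Q. (\<integral>x. h (v, x) \<partial>K v) = enn2real (a 1 v) - enn2real (a (-1) v)"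
    using AE_int by eventually_elim (simp add: real_lebesgue_integral_def a_def)
  have enn: "integrable Q (\<lambda>v. enn2real (a s v))"
    "(\<integral>v. enn2real (a s v) \<partial>Q) = enn2real (\<integral>\<^sup>+p. ennreal (s * h (add (fst p) (snd p), snd p)) \<partial>(Q \<Otimes>\<^sub>M R))"
    for s
  proof -
    have "(\<integral>\<^sup>+v. ennreal (enn2real (a s v)) \<partial>Q) = (\<integral>\<^sup>+v. a s v \<partial>Q)"
      using a_AE[of s] by (intro nn_integral_cong_AE) (auto elim!: eventually_mono)
    then show "integrable Q (\<lambda>v. enn2real (a s v))"
      "(\<integral>v. enn2real (a s v) \<partial>Q) = enn2real (\<integral>\<^sup>+p. ennreal (s * h (add (fst p) (snd p), snd p)) \<partial>(Q \<Otimes>\<^sub>M R))"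
      using a_fin[of s] a_int[of s] by (auto intro!: integrableI_nonneg simp: integral_eq_nn_integral)
  qed
  \<comment> \<open>An almost sure identity does not give measurability, as \<open>Q\<close> need
    not be complete. The 0 in the else branch is the value of the Bochner integral of a
    non-integrable function, so this identity holds at every \<open>v\<close>.\<close>
  have Kmeas: "(\<lambda>v. \<integral>x. h (v, x) \<partial>K v) \<in> borel_measurable Q"
  proof -
    have "(\<lambda>v. if a 1 v < \<infinity> \<and> a (-1) v < \<infinity> then enn2real (a 1 v) - enn2real (a (-1) v) else 0) \<in> borel_measurable Q"
      by measurable
    also have "?this \<longleftrightarrow> ?thesis"
    proof (rule measurable_cong)
      fix v assume v: "v \<in> space Q"
      have "integrable (K v) (\<lambda>x. h (v, x)) \<longleftrightarrow> a 1 v < \<infinity> \<and> a (-1) v < \<infinity>"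
        using h_meas[OF v] by (auto simp: real_integrable_def a_def less_top)
      then show "(if a 1 v < \<infinity> \<and> a (-1) v < \<infinity> then enn2real (a 1 v) - enn2real (a (-1) v) else 0) = (\<integral>x. h (v, x) \<partial>K v)"
        by (auto simp: real_lebesgue_integral_def a_def not_integrable_integral_eq)
    qed
    finally show ?thesis .
  qed
  show "integrable Q (\<lambda>v. \<integral>x. h (v, x) \<partial>K v)"
    using eq by (subst integrable_cong_AE[OF Kmeas _ eq]) (auto intro: enn)
  have "(\<integral>v. (\<integral>x. h (v, x) \<partial>K v) \<partial>Q) = (\<integral>v. enn2real (a 1 v) - enn2real (a (-1) v) \<partial>Q)"
    by (rule integral_cong_AE[OF Kmeas _ eq]) simp
  also have "\<dots> = (\<integral>p. h (add (fst p) (snd p), snd p) \<partial>(Q \<Otimes>\<^sub>M R))"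
    using int by (simp add: enn real_lebesgue_integral_def)
  finally show "(\<integral>v. (\<integral>x. h (v, x) \<partial>K v) \<partial>Q) = (\<integral>p. h (add (fst p) (snd p), snd p) \<partial>(Q \<Otimes>\<^sub>M R))" .
qed

text \<open>
  \<open>delta w\<close> is the Kabanov--Skorohod integral of \<open>(v, x) \<mapsto> w (add v x, x)\<close>. Parametrising the integrand by \<open>w\<close>
  avoids the removal of a point from a configuration.
\<close>

definition delta :: "('n \<times> 'a \<Rightarrow> real) \<Rightarrow> 'n \<Rightarrow> real" where
  "delta w v = (\<integral>x. w (v, x) \<partial>K v) - (\<integral>x. w (add v x, x) \<partial>R)"

section \<open>Pathwise bounds for the Kabanov-Skorohod integral of a bounded integrand\<close>

lemma integrable_bounded:
  fixes w :: "'n \<times> 'a \<Rightarrow> real"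
  assumes [measurable]: "w \<in> borel_measurable (Q \<Otimes>\<^sub>M R)" and k: "\<And>p. \<bar>w p\<bar> \<le> k"
  shows "v \<in> space Q \<Longrightarrow> integrable (K v) (\<lambda>x. w (v, x))"
    and "v \<in> space Q \<Longrightarrow> integrable R (\<lambda>x. w (add v x, x))"
    and "integrable (Q \<Otimes>\<^sub>M R) (\<lambda>p. w (add (fst p) (snd p), snd p))"
proof -
  show "integrable (K v) (\<lambda>x. w (v, x))" if "v \<in> space Q"
    by (rule finite_measure.integrable_const_bound[OF finite_K[OF that], of _ k])
      (use that k in \<open>auto simp: measurable_K\<close>)
  show "integrable R (\<lambda>x. w (add v x, x))" if "v \<in> space Q"
    by (rule R.integrable_const_bound[of _ k]) (use that k in auto)
  show "integrable (Q \<Otimes>\<^sub>M R) (\<lambda>p. w (add (fst p) (snd p), snd p))"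
    by (rule QR.integrable_const_bound[of _ k]) (use k in auto)
qed

lemma delta_measurable:
  assumes w [measurable]: "w \<in> borel_measurable (Q \<Otimes>\<^sub>M R)" and k: "\<And>p. \<bar>w p\<bar> \<le> k"
  shows "delta w \<in> borel_measurable Q"
proof -
  have [measurable]: "(\<lambda>v. \<integral>x. w (v, x) \<partial>K v) \<in> borel_measurable Q"
    by (rule borel_measurable_integrable[OF mecke_integral(2)[OF w integrable_bounded(3)[OF w k]]])
  show ?thesis
    unfolding delta_def by measurable
qed

lemma abs_delta_le:
  assumes w [measurable]: "w \<in> borel_measurable (Q \<Otimes>\<^sub>M R)" and k: "\<And>p. \<bar>w p\<bar> \<le> k"
    and v: "v \<in> space Q"
  shows "\<bar>delta w v\<bar> \<le> k * (mass v + measure R (space R))"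
proof -
  interpret Kv: finite_measure "K v"
    by (rule finite_K[OF v])
  have "\<bar>\<integral>x. w (v, x) \<partial>K v\<bar> \<le> (\<integral>x. k \<partial>K v)"
    using k integrable_bounded(1)[OF w k v]
    by (intro integral_abs_bound[THEN order_trans] integral_mono) auto
  moreover have "\<bar>\<integral>x. w (add v x, x) \<partial>R\<bar> \<le> (\<integral>x. k \<partial>R)"
    using k integrable_bounded(2)[OF w k v]
    by (intro integral_abs_bound[THEN order_trans] integral_mono) auto
  ultimately show ?thesis
    using v by (simp add: delta_def mass_def space_K algebra_simps)
qed

text \<open>The pathwise bound is affine in \<open>mass\<close>, so the two moments of
  \<open>mass\<close> suffice.\<close>

lemma integrable_delta_square:
  assumes w [measurable]: "w \<in> borel_measurable (Q \<Otimes>\<^sub>M R)" and k: "\<And>p. \<bar>w p\<bar> \<le> k"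
  shows "integrable Q (\<lambda>v. (delta w v)\<^sup>2)"
proof (rule Bochner_Integration.integrable_bound)
  let ?r = "measure R (space R)"
  have "(\<lambda>v. (k * (mass v + ?r))\<^sup>2) = (\<lambda>v. k\<^sup>2 * (mass v)\<^sup>2 + 2 * k\<^sup>2 * ?r * mass v + k\<^sup>2 * ?r\<^sup>2)"
    by (simp add: fun_eq_iff power2_eq_square algebra_simps)
  moreover have "integrable Q (\<lambda>v. k\<^sup>2 * (mass v)\<^sup>2 + 2 * k\<^sup>2 * ?r * mass v + k\<^sup>2 * ?r\<^sup>2)"
    using integrable_mass integrable_mass_square by (intro Bochner_Integration.integrable_add) auto
  ultimately show "integrable Q (\<lambda>v. (k * (mass v + ?r))\<^sup>2)"
    by simp
  show "(\<lambda>v. (delta w v)\<^sup>2) \<in> borel_measurable Q"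
    using delta_measurable[OF w k] by simp
  show "AE v in Q. norm ((delta w v)\<^sup>2) \<le> norm ((k * (mass v + ?r))\<^sup>2)"
    using AE_space
  proof eventually_elim
    case (elim v)
    have "\<bar>delta w v\<bar>\<^sup>2 \<le> (k * (mass v + ?r))\<^sup>2"
      by (rule power_mono[OF abs_delta_le[OF w k elim]]) simp
    then show ?case by simp
  qed
qed

lemma integrable_fst:
  fixes f :: "'n \<Rightarrow> real"
  assumes "integrable Q f"
  shows "integrable (Q \<Otimes>\<^sub>M R) (\<lambda>p. f (fst p))"
  using assms by (intro QR.Fubini_integrable) auto

text \<open>The operator \<open>delta\<close> is adjoint to the difference operator. The Mecke
  formula for \<open>\<phi> v * w (v, x)\<close> evaluates \<phi> at the enlarged configuration,
  whereas Fubini applied to the compensator leaves \<phi> at the original one; subtracting produces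
  the difference of \<phi>.\<close>

lemma integration_by_parts:
  assumes w [measurable]: "w \<in> borel_measurable (Q \<Otimes>\<^sub>M R)" and k: "\<And>p. \<bar>w p\<bar> \<le> k"
    and \<phi> [measurable]: "\<phi> \<in> borel_measurable Q" and \<phi>2: "integrable Q (\<lambda>v. (\<phi> v)\<^sup>2)"
  shows "integrable Q (\<lambda>v. \<phi> v * delta w v)"
    and "integrable (Q \<Otimes>\<^sub>M R) (\<lambda>p. \<phi> (add (fst p) (snd p)) - \<phi> (fst p))"
    and "integrable (Q \<Otimes>\<^sub>M R)
      (\<lambda>p. (\<phi> (add (fst p) (snd p)) - \<phi> (fst p)) * w (add (fst p) (snd p), snd p))"
    and "(\<integral>v. \<phi> v * delta w v \<partial>Q) =
      (\<integral>p. (\<phi> (add (fst p) (snd p)) - \<phi> (fst p)) * w (add (fst p) (snd p), snd p) \<partial>(Q \<Otimes>\<^sub>M R))"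
proof -
  have k0: "0 \<le> k" using k[of undefined] by linarith
  show "integrable Q (\<lambda>v. \<phi> v * delta w v)"
    using delta_measurable[OF w k] integrable_delta_square[OF w k] \<phi>2
    by (intro integrable_mult_of_squares) auto
  \<comment> \<open>By the Mecke formula the L1 norm of the shifted function is the integral of
    |\<phi>| times \<open>mass\<close>, a product of two square integrable functions.\<close>
  have shift: "integrable (Q \<Otimes>\<^sub>M R) (\<lambda>p. \<phi> (add (fst p) (snd p)))"
  proof (rule integrableI_bounded)
    have "(\<integral>\<^sup>+p. ennreal (norm (\<phi> (add (fst p) (snd p)))) \<partial>(Q \<Otimes>\<^sub>M R)) =
        (\<integral>\<^sup>+v. ennreal \<bar>\<phi> v\<bar> * ennreal (mass v) \<partial>Q)"
      by (subst nn_integral_mult_mass) auto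
    also have "\<dots> = (\<integral>\<^sup>+v. ennreal (norm (\<phi> v * mass v)) \<partial>Q)"
      by (simp add: ennreal_mult'[symmetric] abs_mult mass_nonneg)
    also have "\<dots> < \<infinity>"
      using integrable_mult_of_squares[OF \<phi> mass_measurable \<phi>2 integrable_mass_square]
      by (simp add: integrable_iff_bounded)
    finally show "(\<integral>\<^sup>+p. ennreal (norm (\<phi> (add (fst p) (snd p)))) \<partial>(Q \<Otimes>\<^sub>M R)) < \<infinity>" .
  qed simp
  have base: "integrable (Q \<Otimes>\<^sub>M R) (\<lambda>p. \<phi> (fst p))"
    by (rule integrable_fst[OF Q.square_integrable_imp_integrable[OF \<phi> \<phi>2]])
  show "integrable (Q \<Otimes>\<^sub>M R) (\<lambda>p. \<phi> (add (fst p) (snd p)) - \<phi> (fst p))"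
    using shift base by simp
  have mult: "integrable (Q \<Otimes>\<^sub>M R) (\<lambda>p. f p * w (add (fst p) (snd p), snd p))"
    if f: "integrable (Q \<Otimes>\<^sub>M R) f" for f
  proof (rule Bochner_Integration.integrable_bound)
    show "integrable (Q \<Otimes>\<^sub>M R) (\<lambda>p. k * f p)"
      using f by simp
    show "(\<lambda>p. f p * w (add (fst p) (snd p), snd p)) \<in> borel_measurable (Q \<Otimes>\<^sub>M R)"
      using f by measurable
    show "AE p in Q \<Otimes>\<^sub>M R. norm (f p * w (add (fst p) (snd p), snd p)) \<le> norm (k * f p)"
      using k k0 by (auto simp: abs_mult mult.commute[of k] intro!: mult_left_mono)
  qed
  show "integrable (Q \<Otimes>\<^sub>M R)
      (\<lambda>p. (\<phi> (add (fst p) (snd p)) - \<phi> (fst p)) * w (add (fst p) (snd p), snd p))"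
    using shift base by (intro mult) simp
  have h [measurable]: "(\<lambda>p. \<phi> (fst p) * w p) \<in> borel_measurable (Q \<Otimes>\<^sub>M R)"
    by measurable
  note M = mecke_integral[OF h, simplified, OF mult[OF shift]]
  have "(\<integral>v. \<phi> v * (\<integral>x. w (add v x, x) \<partial>R) \<partial>Q) = (\<integral>v. (\<integral>x. \<phi> v * w (add v x, x) \<partial>R) \<partial>Q)"
    by simp
  also have "\<dots> = (\<integral>p. \<phi> (fst p) * w (add (fst p) (snd p), snd p) \<partial>(Q \<Otimes>\<^sub>M R))"
    using QR.integral_fst'[OF mult[OF base]] by simp
  finally have 1: "(\<integral>v. \<phi> v * (\<integral>x. w (add v x, x) \<partial>R) \<partial>Q) =
      (\<integral>p. \<phi> (fst p) * w (add (fst p) (snd p), snd p) \<partial>(Q \<Otimes>\<^sub>M R))" .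
  have 2: "integrable Q (\<lambda>v. \<phi> v * (\<integral>x. w (add v x, x) \<partial>R))"
    using QR.integrable_fst'[OF mult[OF base]] by simp
  have "(\<integral>v. \<phi> v * delta w v \<partial>Q) =
      (\<integral>v. \<phi> v * (\<integral>x. w (v, x) \<partial>K v) - \<phi> v * (\<integral>x. w (add v x, x) \<partial>R) \<partial>Q)"
    by (simp add: delta_def right_diff_distrib)
  also have "\<dots> = (\<integral>p. \<phi> (add (fst p) (snd p)) * w (add (fst p) (snd p), snd p) \<partial>(Q \<Otimes>\<^sub>M R)) -
      (\<integral>p. \<phi> (fst p) * w (add (fst p) (snd p), snd p) \<partial>(Q \<Otimes>\<^sub>M R))"
    using M 2 by (simp add: 1)
  also have "\<dots> = (\<integral>p. (\<phi> (add (fst p) (snd p)) - \<phi> (fst p)) * w (add (fst p) (snd p), snd p) \<partial>(Q \<Otimes>\<^sub>M R))"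
    using mult[OF shift] mult[OF base] by (simp add: left_diff_distrib)
  finally show "(\<integral>v. \<phi> v * delta w v \<partial>Q) =
      (\<integral>p. (\<phi> (add (fst p) (snd p)) - \<phi> (fst p)) * w (add (fst p) (snd p), snd p) \<partial>(Q \<Otimes>\<^sub>M R))" .
qed

section \<open>Second moment of the Kabanov-Skorohod integral\<close>

lemma nn_integral_swap_points:
  assumes [measurable]: "f \<in> borel_measurable ((Q \<Otimes>\<^sub>M R) \<Otimes>\<^sub>M R)"
  shows "(\<integral>\<^sup>+q. f ((fst (fst q), snd q), snd (fst q)) \<partial>((Q \<Otimes>\<^sub>M R) \<Otimes>\<^sub>M R)) =
    (\<integral>\<^sup>+q. f q \<partial>((Q \<Otimes>\<^sub>M R) \<Otimes>\<^sub>M R))"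
proof -
  interpret RR: pair_sigma_finite R R by unfold_locales
  have "(\<integral>\<^sup>+q. f ((fst (fst q), snd q), snd (fst q)) \<partial>((Q \<Otimes>\<^sub>M R) \<Otimes>\<^sub>M R)) =
      (\<integral>\<^sup>+v. \<integral>\<^sup>+x. \<integral>\<^sup>+y. f ((v, y), x) \<partial>R \<partial>R \<partial>Q)"
    by (simp add: R.nn_integral_fst[symmetric])
  also have "\<dots> = (\<integral>\<^sup>+v. \<integral>\<^sup>+y. \<integral>\<^sup>+x. f ((v, y), x) \<partial>R \<partial>R \<partial>Q)"
    by (intro nn_integral_cong RR.Fubini') simp
  also have "\<dots> = (\<integral>\<^sup>+q. f q \<partial>((Q \<Otimes>\<^sub>M R) \<Otimes>\<^sub>M R))"
    by (simp add: R.nn_integral_fst[symmetric])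
  finally show ?thesis .
qed

text \<open>The commutation rule D_x delta(u) = u_x + delta(D_x u): the new point contributes the
  summand u_x, and the other summands and the compensator see the integrand at the shifted
  configuration. Since points may be added in either order, D_x u is again represented by a function
  of (configuration with the point, point). The function integrated over \<open>K\<close> here
  depends on v and x, which is why the exceptional set in \<open>nn_integral_K_add\<close> must be
  the same for all \<open>f\<close>.\<close>

lemma delta_add:
  assumes w [measurable]: "w \<in> borel_measurable (Q \<Otimes>\<^sub>M R)" and k: "\<And>p. \<bar>w p\<bar> \<le> k"
  shows "AE p in Q \<Otimes>\<^sub>M R. delta w (add (fst p) (snd p)) - delta w (fst p) =
    w (add (fst p) (snd p), snd p) + delta (\<lambda>q. w (add (fst q) (snd p), snd q) - w q) (fst p)"
  using nn_integral_K_add AE_space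
proof eventually_elim
  case (elim p)
  obtain v x where p: "p = (v, x)" by (cases p)
  have [measurable]: "x \<in> space R" and v: "v \<in> space Q" and vx: "add v x \<in> space Q"
    using elim(2) by (auto simp: p space_pair_measure add_in_space)
  interpret Kv: finite_measure "K v" by (rule finite_K[OF v])
  interpret Kvx: finite_measure "K (add v x)" by (rule finite_K[OF vx])
  have shift: "(\<integral>y. f y \<partial>K (add v x)) = f x + (\<integral>y. f y \<partial>K v)"
    if [measurable]: "f \<in> borel_measurable R" and b: "\<And>y. \<bar>f y\<bar> \<le> k" for f
  proof -
    have nn: "(\<integral>\<^sup>+y. ennreal (g y) \<partial>K (add v x)) = ennreal (g x) + (\<integral>\<^sup>+y. ennreal (g y) \<partial>K v)"
      if "g \<in> borel_measurable R" for g :: "'a \<Rightarrow> real"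
      using bspec[OF elim(1), of "\<lambda>y. ennreal (g y)"] that by (simp add: p)
    have int: "integrable (K v) f" "integrable (K (add v x)) f"
      using b that by (auto intro!: Kv.integrable_const_bound[of _ k] Kvx.integrable_const_bound[of _ k]
        simp: measurable_K v vx)
    have "enn2real (ennreal (g x) + (\<integral>\<^sup>+y. ennreal (g y) \<partial>K v)) =
        max 0 (g x) + enn2real (\<integral>\<^sup>+y. ennreal (g y) \<partial>K v)" if "integrable (K v) g" for g
    proof -
      have "(\<integral>\<^sup>+y. ennreal (g y) \<partial>K v) < top"
        using that by (simp add: real_integrable_def less_top)
      then show ?thesis
        by (subst enn2real_plus) (auto simp: max_def ennreal_neg)
    qed
    note e = this
    show ?thesis
      unfolding real_lebesgue_integral_def[OF int(1)] real_lebesgue_integral_def[OF int(2)]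
      using e[of f] e[of "\<lambda>x. - f x"] int by (simp add: nn max_def)
  qed
  have 1: "(\<integral>y. w (add v x, y) \<partial>K (add v x)) = w (add v x, x) + (\<integral>y. w (add v x, y) \<partial>K v)"
    by (rule shift) (use vx k in auto)
  have meas: "(\<lambda>q. w (add (fst q) x, snd q)) \<in> borel_measurable (Q \<Otimes>\<^sub>M R)"
    by measurable
  have bd: "\<And>q. \<bar>w (add (fst q) x, snd q)\<bar> \<le> k"
    using k by simp
  note i1 = integrable_bounded(1,2)[OF w k] and i2 = integrable_bounded(1,2)[OF meas bd, simplified]
  have comm: "w (add (add v y) x, y) = w (add (add v x) y, y)" for y
    by (simp add: add_commute)
  show ?case
    using i1[OF v] i2[OF v] i1(2)[OF vx] unfolding p delta_def by (simp add: 1 comm)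
qed

text \<open>Integration by parts is applied to \<open>delta w\<close> itself and then, after the
  commutation rule, to u_x for each fixed x. The resulting mixed term couples D_y u_x with D_x u_y;
  these are exchanged by swapping the two points, so bounding the product by the mean of the squares
  leaves a single square integral.\<close>

lemma delta_square_le:
  assumes w [measurable]: "w \<in> borel_measurable (Q \<Otimes>\<^sub>M R)" and k: "\<And>p. \<bar>w p\<bar> \<le> k"
  shows "ennreal (\<integral>v. (delta w v)\<^sup>2 \<partial>Q) \<le>
    (\<integral>\<^sup>+p. ennreal ((w (add (fst p) (snd p), snd p))\<^sup>2) \<partial>(Q \<Otimes>\<^sub>M R)) +
    (\<integral>\<^sup>+((v, y), x). ennreal ((w (add (add v y) x, x) - w (add v x, x))\<^sup>2) \<partial>((Q \<Otimes>\<^sub>M R) \<Otimes>\<^sub>M R))"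
proof -
  interpret QRR: pair_sigma_finite "Q \<Otimes>\<^sub>M R" R by unfold_locales
  interpret RQ: pair_sigma_finite R Q by unfold_locales
  interpret QRR: finite_measure "(Q \<Otimes>\<^sub>M R) \<Otimes>\<^sub>M R"
    by (rule finite_measure_pair_measure) unfold_locales
  have k0: "0 \<le> k" using k[of undefined] by linarith
  have G [measurable]: "delta w \<in> borel_measurable Q"
    by (rule delta_measurable[OF w k])
  note G2 = integrable_delta_square[OF w k]
  \<comment> \<open>For p = (v, x) and q = ((v, y), x): \<open>u p\<close> is u_x,
    \<open>d p\<close> is almost everywhere delta(D_x u), \<open>D q\<close> is D_y u_x and
    \<open>D' q\<close> is D_x u_y.\<close>
  define u where "u p = w (add (fst p) (snd p), snd p)" for p
  define d where "d p = delta w (add (fst p) (snd p)) - delta w (fst p) - u p" for p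
  define D where "D q = w (add (add (fst (fst q)) (snd (fst q))) (snd q), snd q) -
    w (add (fst (fst q)) (snd q), snd q)" for q
  define D' where "D' q = D ((fst (fst q), snd q), snd (fst q))" for q
  have [measurable]: "u \<in> borel_measurable (Q \<Otimes>\<^sub>M R)" "d \<in> borel_measurable (Q \<Otimes>\<^sub>M R)"
    "D \<in> borel_measurable ((Q \<Otimes>\<^sub>M R) \<Otimes>\<^sub>M R)" "D' \<in> borel_measurable ((Q \<Otimes>\<^sub>M R) \<Otimes>\<^sub>M R)"
    unfolding u_def d_def D_def D'_def by measurable
  have u_le: "\<bar>u p\<bar> \<le> k" for p
    unfolding u_def by (rule k)
  have D_le: "\<bar>D q\<bar> \<le> 2 * k" for q
    using k[of "(add (add (fst (fst q)) (snd (fst q))) (snd q), snd q)"]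
      k[of "(add (fst (fst q)) (snd q), snd q)"] unfolding D_def by linarith
  have D'_le: "\<bar>D' q\<bar> \<le> 2 * k" for q
    unfolding D'_def by (rule D_le)
  have intD: "integrable ((Q \<Otimes>\<^sub>M R) \<Otimes>\<^sub>M R) (\<lambda>q. (D q)\<^sup>2)"
    "integrable ((Q \<Otimes>\<^sub>M R) \<Otimes>\<^sub>M R) (\<lambda>q. (D' q)\<^sup>2)"
    using power_mono[OF D_le abs_ge_zero, of _ 2] power_mono[OF D'_le abs_ge_zero, of _ 2]
    by (auto intro!: QRR.integrable_const_bound[of _ "(2 * k)\<^sup>2"])
  have intDD: "integrable ((Q \<Otimes>\<^sub>M R) \<Otimes>\<^sub>M R) (\<lambda>q. D q * D' q)"
    using intD by (intro integrable_mult_of_squares) auto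
  have intu: "integrable (Q \<Otimes>\<^sub>M R) u" "integrable (Q \<Otimes>\<^sub>M R) (\<lambda>p. (u p)\<^sup>2)"
    using u_le power_mono[OF u_le abs_ge_zero, of _ 2]
    by (auto intro: QR.integrable_const_bound[of _ k, OF AE_I2] QR.integrable_const_bound[of _ "k\<^sup>2", OF AE_I2])
  have d: "AE p in Q \<Otimes>\<^sub>M R. d p = delta (\<lambda>q. w (add (fst q) (snd p), snd q) - w q) (fst p)"
    using delta_add[OF w k] by eventually_elim (simp add: d_def u_def)
  have intdu: "integrable (Q \<Otimes>\<^sub>M R) (\<lambda>p. d p * u p)"
    using integration_by_parts(3)[OF w k G G2] intu(2)
    unfolding d_def u_def[symmetric] by (simp add: left_diff_distrib power2_eq_square)

  have du: "(\<integral>p. d p * u p \<partial>(Q \<Otimes>\<^sub>M R)) = (\<integral>q. D q * D' q \<partial>((Q \<Otimes>\<^sub>M R) \<Otimes>\<^sub>M R))"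
  proof -
    \<comment> \<open>The coordinates are swapped to make x the outer variable: the second
      integration by parts takes place in v while x stays fixed.\<close>
    have "AE p in R \<Otimes>\<^sub>M Q. d (snd p, fst p) = delta (\<lambda>q. w (add (fst q) (fst p), snd q) - w q) (snd p)"
    proof -
      have "AE p in distr (R \<Otimes>\<^sub>M Q) (Q \<Otimes>\<^sub>M R) (\<lambda>(x, v). (v, x)).
          d p = delta (\<lambda>q. w (add (fst q) (snd p), snd q) - w q) (fst p)"
        using d by (subst QR.distr_pair_swap[symmetric])
      from AE_distrD[OF measurable_pair_swap' this] show ?thesis
        by (simp add: split_beta')
    qed
    then have "AE x in R. AE v in Q. d (v, x) = delta (\<lambda>q. w (add (fst q) x, snd q) - w q) v"
      using RQ.AE_pair by fastforce
    then have inner: "AE x in R. (\<integral>v. d (v, x) * u (v, x) \<partial>Q) = (\<integral>p. D (p, x) * D' (p, x) \<partial>(Q \<Otimes>\<^sub>M R))"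
      using AE_space
    proof eventually_elim
      case (elim x)
      note [measurable] = elim(2)
      let ?w = "\<lambda>q. w (add (fst q) x, snd q) - w q"
      have w' [measurable]: "?w \<in> borel_measurable (Q \<Otimes>\<^sub>M R)" by measurable
      have k': "\<bar>?w q\<bar> \<le> 2 * k" for q
        using k[of "(add (fst q) x, snd q)"] k[of q] by linarith
      have ux [measurable]: "(\<lambda>v. u (v, x)) \<in> borel_measurable Q" by measurable
      have ux2: "integrable Q (\<lambda>v. (u (v, x))\<^sup>2)"
        using power_mono[OF u_le abs_ge_zero, of _ 2]
        by (auto intro!: Q.integrable_const_bound[of _ "k\<^sup>2"])
      have "(\<integral>v. d (v, x) * u (v, x) \<partial>Q) = (\<integral>v. u (v, x) * delta ?w v \<partial>Q)"
        using elim(1) delta_measurable[OF w' k']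
        by (intro integral_cong_AE) (auto simp: mult.commute)
      \<comment> \<open>Adding y changes u_x by D_y u_x, and \<open>?w\<close> at the enlarged
        configuration is D_x u_y up to the order in which the points are added.\<close>
      also have "\<dots> = (\<integral>p. D (p, x) * D' (p, x) \<partial>(Q \<Otimes>\<^sub>M R))"
        by (subst integration_by_parts(4)[OF w' k' ux ux2]) (simp add: D_def D'_def u_def add_commute)
      finally show ?case .
    qed
    have "(\<integral>p. d p * u p \<partial>(Q \<Otimes>\<^sub>M R)) = (\<integral>x. (\<integral>v. d (v, x) * u (v, x) \<partial>Q) \<partial>R)"
      using QR.integral_snd[of "\<lambda>v x. d (v, x) * u (v, x)"] intdu by (simp add: split_beta')
    also have "\<dots> = (\<integral>x. (\<integral>p. D (p, x) * D' (p, x) \<partial>(Q \<Otimes>\<^sub>M R)) \<partial>R)"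
      by (rule integral_cong_AE[OF _ _ inner]) measurable
    also have "\<dots> = (\<integral>q. D q * D' q \<partial>((Q \<Otimes>\<^sub>M R) \<Otimes>\<^sub>M R))"
      using QRR.integral_snd[of "\<lambda>p x. D (p, x) * D' (p, x)"] intDD by (simp add: split_beta')
    finally show ?thesis .
  qed

  have "(\<integral>q. (D' q)\<^sup>2 \<partial>((Q \<Otimes>\<^sub>M R) \<Otimes>\<^sub>M R)) = (\<integral>q. (D q)\<^sup>2 \<partial>((Q \<Otimes>\<^sub>M R) \<Otimes>\<^sub>M R))"
    unfolding D'_def
    by (simp add: integral_eq_nn_integral nn_integral_swap_points[of "\<lambda>q. ennreal ((D q)\<^sup>2)"])
  moreover have "(\<integral>q. D q * D' q \<partial>((Q \<Otimes>\<^sub>M R) \<Otimes>\<^sub>M R)) \<le>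
      (\<integral>q. ((D q)\<^sup>2 + (D' q)\<^sup>2) / 2 \<partial>((Q \<Otimes>\<^sub>M R) \<Otimes>\<^sub>M R))"
  proof (rule integral_mono[OF intDD])
    show "D q * D' q \<le> ((D q)\<^sup>2 + (D' q)\<^sup>2) / 2" for q
      using sum_squares_bound[of "D q" "D' q"] by simp
  qed (use intD in simp)
  ultimately have DD: "(\<integral>q. D q * D' q \<partial>((Q \<Otimes>\<^sub>M R) \<Otimes>\<^sub>M R)) \<le> (\<integral>q. (D q)\<^sup>2 \<partial>((Q \<Otimes>\<^sub>M R) \<Otimes>\<^sub>M R))"
    using intD by simp
  have "(\<integral>v. (delta w v)\<^sup>2 \<partial>Q) = (\<integral>v. delta w v * delta w v \<partial>Q)"
    by (simp add: power2_eq_square)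
  also have "\<dots> = (\<integral>p. (u p)\<^sup>2 + d p * u p \<partial>(Q \<Otimes>\<^sub>M R))"
    by (subst integration_by_parts(4)[OF w k G G2])
      (simp add: d_def u_def power2_eq_square algebra_simps)
  also have "\<dots> = (\<integral>p. (u p)\<^sup>2 \<partial>(Q \<Otimes>\<^sub>M R)) + (\<integral>q. D q * D' q \<partial>((Q \<Otimes>\<^sub>M R) \<Otimes>\<^sub>M R))"
    using intu intdu by (simp add: du)
  finally have "(\<integral>v. (delta w v)\<^sup>2 \<partial>Q) \<le>
      (\<integral>p. (u p)\<^sup>2 \<partial>(Q \<Otimes>\<^sub>M R)) + (\<integral>q. (D q)\<^sup>2 \<partial>((Q \<Otimes>\<^sub>M R) \<Otimes>\<^sub>M R))"
    using DD by simp
  then have "ennreal (\<integral>v. (delta w v)\<^sup>2 \<partial>Q) \<le>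
      (\<integral>\<^sup>+p. ennreal ((u p)\<^sup>2) \<partial>(Q \<Otimes>\<^sub>M R)) + (\<integral>\<^sup>+q. ennreal ((D q)\<^sup>2) \<partial>((Q \<Otimes>\<^sub>M R) \<Otimes>\<^sub>M R))"
    using intu(2) intD(1) by (simp add: nn_integral_eq_integral ennreal_plus[symmetric] ennreal_leI del: ennreal_plus)
  then show ?thesis
    by (simp add: u_def D_def split_beta')
qed

text \<open>Hypothesis \<open>pos\<close> is what makes a truncated difference admissible: it bounds
  the term linear in t from below by the same integral of u_x^2 that occurs in the quadratic
  term.\<close>

lemma variance_lower_bound:
  assumes w [measurable]: "w \<in> borel_measurable (Q \<Otimes>\<^sub>M R)" and k: "\<And>p. \<bar>w p\<bar> \<le> k"
    and \<phi> [measurable]: "\<phi> \<in> borel_measurable Q" and \<phi>2: "integrable Q (\<lambda>v. (\<phi> v)\<^sup>2)"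
    and pos: "AE p in Q \<Otimes>\<^sub>M R. (w (add (fst p) (snd p), snd p))\<^sup>2 \<le>
      (\<phi> (add (fst p) (snd p)) - \<phi> (fst p)) * w (add (fst p) (snd p), snd p)"
    and t: "0 \<le> t"
  shows "ennreal (2 * t) * (\<integral>\<^sup>+p. ennreal ((w (add (fst p) (snd p), snd p))\<^sup>2) \<partial>(Q \<Otimes>\<^sub>M R)) \<le>
    ennreal (Q.variance \<phi>) + ennreal (t\<^sup>2) *
      ((\<integral>\<^sup>+p. ennreal ((w (add (fst p) (snd p), snd p))\<^sup>2) \<partial>(Q \<Otimes>\<^sub>M R)) +
       (\<integral>\<^sup>+((v, y), x). ennreal ((w (add (add v y) x, x) - w (add v x, x))\<^sup>2) \<partial>((Q \<Otimes>\<^sub>M R) \<Otimes>\<^sub>M R)))"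
proof -
  define m where "m = (\<integral>v. \<phi> v \<partial>Q)"
  define u where "u p = w (add (fst p) (snd p), snd p)" for p
  have G [measurable]: "delta w \<in> borel_measurable Q"
    by (rule delta_measurable[OF w k])
  note G2 = integrable_delta_square[OF w k]
  have [measurable]: "u \<in> borel_measurable (Q \<Otimes>\<^sub>M R)"
    unfolding u_def by measurable
  have intu: "integrable (Q \<Otimes>\<^sub>M R) (\<lambda>p. (u p)\<^sup>2)"
    using power_mono[OF k abs_ge_zero, of _ 2]
    by (auto intro!: QR.integrable_const_bound[of _ "k\<^sup>2"] simp: u_def)
  have \<phi>1: "integrable Q \<phi>"
    by (rule Q.square_integrable_imp_integrable[OF \<phi> \<phi>2])
  \<comment> \<open>Centring leaves all differences of \<phi> unchanged and turns its second moment
    into the variance.\<close>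
  have int: "integrable Q (\<lambda>v. (\<phi> v - m)\<^sup>2)"
    using \<phi>1 \<phi>2 by (simp add: power2_diff)
  have [measurable]: "(\<lambda>v. \<phi> v - m) \<in> borel_measurable Q" by measurable
  note ibp = integration_by_parts[OF w k this int]
  have "(\<integral>p. (u p)\<^sup>2 \<partial>(Q \<Otimes>\<^sub>M R)) \<le> (\<integral>v. (\<phi> v - m) * delta w v \<partial>Q)"
    unfolding ibp(4) using pos ibp(3) intu by (intro integral_mono_AE) (auto simp: u_def)
  then have "2 * t * (\<integral>p. (u p)\<^sup>2 \<partial>(Q \<Otimes>\<^sub>M R)) \<le> 2 * t * (\<integral>v. (\<phi> v - m) * delta w v \<partial>Q)"
    using t by (intro mult_left_mono) auto
  also have "\<dots> = (\<integral>v. 2 * t * ((\<phi> v - m) * delta w v) \<partial>Q)"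
    by simp
  also have "\<dots> \<le> (\<integral>v. (\<phi> v - m)\<^sup>2 + t\<^sup>2 * (delta w v)\<^sup>2 \<partial>Q)"
  proof (rule integral_mono)
    show "2 * t * ((\<phi> v - m) * delta w v) \<le> (\<phi> v - m)\<^sup>2 + t\<^sup>2 * (delta w v)\<^sup>2" for v
      using sum_squares_bound[of "\<phi> v - m" "t * delta w v"] unfolding power_mult_distrib by (simp only: ac_simps)
  qed (use ibp(1) int G2 in auto)
  also have "\<dots> = Q.variance \<phi> + t\<^sup>2 * (\<integral>v. (delta w v)\<^sup>2 \<partial>Q)"
    using int G2 by (simp add: m_def)
  finally have "ennreal (2 * t * (\<integral>p. (u p)\<^sup>2 \<partial>(Q \<Otimes>\<^sub>M R))) \<le>
      ennreal (Q.variance \<phi> + t\<^sup>2 * (\<integral>v. (delta w v)\<^sup>2 \<partial>Q))"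
    by (rule ennreal_leI)
  then have "ennreal (2 * t) * (\<integral>\<^sup>+p. ennreal ((u p)\<^sup>2) \<partial>(Q \<Otimes>\<^sub>M R)) \<le>
      ennreal (Q.variance \<phi>) + ennreal (t\<^sup>2) * ennreal (\<integral>v. (delta w v)\<^sup>2 \<partial>Q)"
    using t by (simp add: nn_integral_eq_integral[OF intu] ennreal_mult'[symmetric])
  also have "\<dots> \<le> ennreal (Q.variance \<phi>) + ennreal (t\<^sup>2) *
      ((\<integral>\<^sup>+p. ennreal ((w (add (fst p) (snd p), snd p))\<^sup>2) \<partial>(Q \<Otimes>\<^sub>M R)) +
       (\<integral>\<^sup>+((v, y), x). ennreal ((w (add (add v y) x, x) - w (add v x, x))\<^sup>2) \<partial>((Q \<Otimes>\<^sub>M R) \<Otimes>\<^sub>M R)))"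
    by (intro add_left_mono mult_left_mono delta_square_le[OF w k]) auto
  finally show ?thesis
    by (simp add: u_def)
qed

end

subsection \<open>Measurability on the space of counting measures\<close>

lemma measurable_counting_algebraI:
  assumes "\<And>x. x \<in> space M \<Longrightarrow> f x \<in> counting_measures L"
    and "\<And>B. B \<in> sets L \<Longrightarrow> (\<lambda>x. emeasure (f x) B) \<in> borel_measurable M"
  shows "f \<in> M \<rightarrow>\<^sub>M counting_algebra L"
  unfolding counting_algebra_def
  using assms by (intro measurable_SUP2 measurable_vimage_algebra2) auto

lemma counting_measuresD:
  assumes "\<nu> \<in> counting_measures L"
  shows "sets \<nu> = sets L" "space \<nu> = space L" "sigma_finite_measure \<nu>"
    "\<And>B. B \<in> sets L \<Longrightarrow> emeasure \<nu> B \<in> range ennreal_of_enat"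
  using assms sets_eq_imp_space_eq[of \<nu> L] by (auto simp: counting_measures_def)

lemma measurable_emeasure_counting_algebra' [measurable (raw)]:
  assumes "f \<in> M \<rightarrow>\<^sub>M counting_algebra L" "B \<in> sets L"
  shows "(\<lambda>x. emeasure (f x) B) \<in> borel_measurable M"
  using measurable_compose[OF assms(1) measurable_emeasure_counting_algebra[OF assms(2)]] .

lemma emeasure_add_point_counting:
  "\<nu> \<in> counting_measures L \<Longrightarrow> B \<in> sets L \<Longrightarrow>
    emeasure (add_point \<nu> x) B = emeasure \<nu> B + indicator B x"
  by (simp add: emeasure_add_point counting_measuresD)

lemma measurable_add_point [measurable (raw)]:
  assumes f: "f \<in> M \<rightarrow>\<^sub>M counting_algebra L" and g [measurable]: "g \<in> M \<rightarrow>\<^sub>M L"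
  shows "(\<lambda>x. add_point (f x) (g x)) \<in> M \<rightarrow>\<^sub>M counting_algebra L"
proof (rule measurable_counting_algebraI)
  have cm: "f x \<in> counting_measures L" if "x \<in> space M" for x
    using measurable_space[OF f that] by (simp add: space_counting_algebra)
  then show "add_point (f x) (g x) \<in> counting_measures L" if "x \<in> space M" for x
    using that by (simp add: add_point_counting_measures)
  show "(\<lambda>x. emeasure (add_point (f x) (g x)) B) \<in> borel_measurable M" if [measurable]: "B \<in> sets L" for B
  proof -
    have "(\<lambda>x. emeasure (f x) B + indicator B (g x)) \<in> borel_measurable M"
      using f by measurable
    then show ?thesis
      by (rule measurable_cong[THEN iffD1, rotated]) (simp add: emeasure_add_point_counting[OF cm that])
  qed
qed

text \<open>Doob-Dynkin factorisation. For rational q the event q < f is the preimage under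
  \<open>T\<close> of some \<open>E q\<close>, and f(x) is the supremum of the rationals q with T x
  in \<open>E q\<close>; the latter description involves x only through T x.\<close>

lemma borel_measurable_vimage_algebra_factor:
  fixes f :: "'b \<Rightarrow> real"
  assumes T: "T \<in> X \<rightarrow> space M" and f: "f \<in> borel_measurable (vimage_algebra X T M)"
  obtains g where "g \<in> borel_measurable M" "\<And>x. x \<in> X \<Longrightarrow> f x = g (T x)"
proof -
  have "\<exists>E\<in>sets M. {x\<in>X. real_of_rat q < f x} = T -` E \<inter> X" for q
  proof -
    have "{x\<in>space (vimage_algebra X T M). real_of_rat q < f x} \<in> sets (vimage_algebra X T M)"
      using f by measurable
    then show ?thesis
      by (auto simp: sets_vimage_algebra2[OF T])
  qed
  then obtain E where E [measurable]: "\<And>q. E q \<in> sets M"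
    and E_eq: "\<And>q. {x\<in>X. real_of_rat q < f x} = T -` E q \<inter> X"
    by metis
  \<comment> \<open>Off the range of \<open>T\<close> the sets \<open>E q\<close> are uncontrolled
    and the supremum may be infinite; \<open>real_of_ereal\<close> then yields 0, so
    \<open>g\<close> stays real-valued and measurable.\<close>
  define g where "g y = real_of_ereal (SUP q. if y \<in> E q then ereal (real_of_rat q) else -\<infinity>)" for y
  have "g \<in> borel_measurable M"
    unfolding g_def by measurable
  moreover have "f x = g (T x)" if x: "x \<in> X" for x
  proof -
    have E_iff: "T x \<in> E q \<longleftrightarrow> real_of_rat q < f x" for q
      using E_eq[of q] x by blast
    have "(SUP q. if T x \<in> E q then ereal (real_of_rat q) else -\<infinity>) = ereal (f x)"
    proof (rule antisym)
      show "(SUP q. if T x \<in> E q then ereal (real_of_rat q) else -\<infinity>) \<le> ereal (f x)"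
        by (rule SUP_least) (auto simp: E_iff)
      show "ereal (f x) \<le> (SUP q. if T x \<in> E q then ereal (real_of_rat q) else -\<infinity>)"
      proof (rule dense_le)
        fix z assume z: "z < ereal (f x)"
        then obtain r where r: "z < ereal r" "r < f x"
          using ereal_dense2[OF z] by auto
        obtain q where q: "r < real_of_rat q" "real_of_rat q < f x"
          using of_rat_dense[OF r(2)] by auto
        have "z \<le> ereal (real_of_rat q)"
          using r(1) q(1) by (metis less_ereal.simps(1) less_imp_le order.strict_trans)
        also have "\<dots> \<le> (SUP q. if T x \<in> E q then ereal (real_of_rat q) else -\<infinity>)"
          by (rule SUP_upper2[of q]) (auto simp: E_iff q)
        finally show "z \<le> (SUP q. if T x \<in> E q then ereal (real_of_rat q) else -\<infinity>)" .
      qed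
    qed
    then show ?thesis
      by (simp add: g_def)
  qed
  ultimately show ?thesis
    using that by blast
qed

text \<open>
  \<open>g\<close> plays the role of \<open>(\<nu>, x) \<mapsto> F (\<nu> - \<delta>\<^sub>x)\<close>. It exists although points may not be measurable,
  since \<open>\<nu>(B) = (\<nu> + \<delta>\<^sub>x)(B) - 1\<^sub>B(x)\<close> depends measurably on \<open>(\<nu> + \<delta>\<^sub>x, x)\<close>.
\<close>

lemma add_point_factorization:
  fixes F :: "'a measure \<Rightarrow> real"
  assumes F: "F \<in> borel_measurable (counting_algebra L)"
  obtains g where "g \<in> borel_measurable (counting_algebra L \<Otimes>\<^sub>M L)"
    "\<And>\<nu> x. \<nu> \<in> counting_measures L \<Longrightarrow> x \<in> space L \<Longrightarrow> g (add_point \<nu> x, x) = F \<nu>"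
proof -
  let ?N = "counting_algebra L"
  let ?X = "space (?N \<Otimes>\<^sub>M L)"
  let ?T = "\<lambda>p. (add_point (fst p) (snd p), snd p)"
  let ?V = "vimage_algebra ?X ?T (?N \<Otimes>\<^sub>M L)"
  have T: "?T \<in> ?X \<rightarrow> space (?N \<Otimes>\<^sub>M L)"
    by (auto simp: space_pair_measure space_counting_algebra add_point_counting_measures)
  have TV: "?T \<in> ?V \<rightarrow>\<^sub>M ?N \<Otimes>\<^sub>M L"
    by (rule measurable_vimage_algebra1[OF T])
  have fst_V: "fst \<in> ?V \<rightarrow>\<^sub>M ?N"
  proof (rule measurable_counting_algebraI)
    show "fst p \<in> counting_measures L" if "p \<in> space ?V" for p
      using that by (auto simp: space_pair_measure space_counting_algebra)
    show "(\<lambda>p. emeasure (fst p) B) \<in> borel_measurable ?V" if B [measurable]: "B \<in> sets L" for B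
    proof -
      \<comment> \<open>In \<open>ennreal\<close> infinity minus 1 is infinity, so the subtraction
        recovers the count of \<open>B\<close> also when it is infinite.\<close>
      have "(\<lambda>q. emeasure (fst q) B - indicator B (snd q)) \<in> borel_measurable (?N \<Otimes>\<^sub>M L)"
        by measurable
      from measurable_compose[OF TV this]
      have "(\<lambda>p. emeasure (add_point (fst p) (snd p)) B - indicator B (snd p)) \<in> borel_measurable ?V"
        by simp
      then show ?thesis
        by (rule measurable_cong[THEN iffD1, rotated])
          (auto simp: space_pair_measure space_counting_algebra emeasure_add_point_counting[OF _ B]
            split: split_indicator)
    qed
  qed
  obtain g where "g \<in> borel_measurable (?N \<Otimes>\<^sub>M L)" "\<And>p. p \<in> ?X \<Longrightarrow> F (fst p) = g (?T p)"
    using borel_measurable_vimage_algebra_factor[OF T measurable_compose[OF fst_V F]] by blast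
  then show ?thesis
    by (intro that[of g]) (auto simp: space_pair_measure space_counting_algebra)
qed

subsection \<open>Uniqueness of measures on the space of counting measures\<close>

text \<open>Atoms are indexed by membership patterns, the nonempty subfamilies of the given class,
  and \<open>J C\<close> collects the patterns that contain \<open>C\<close>. The empty pattern is
  left out because its atom, the complement of the union, may have infinite intensity. Some atoms
  may be empty sets.\<close>

lemma finite_atoms:
  assumes "finite \<C>" "\<C> \<subseteq> sets M"
  obtains m and D :: "nat \<Rightarrow> 'a set" and J where
    "disjoint_family_on D {..<m}" "\<And>j. j < m \<Longrightarrow> D j \<in> sets M"
    "\<And>j. j < m \<Longrightarrow> \<exists>C\<in>\<C>. D j \<subseteq> C"
    "\<And>C. C \<in> \<C> \<Longrightarrow> J C \<subseteq> {..<m}" "\<And>C. C \<in> \<C> \<Longrightarrow> C = (\<Union>j\<in>J C. D j)"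
proof -
  have "finite (Pow \<C> - {{}})"
    using assms(1) by simp
  then obtain h where h: "bij_betw h {..<card (Pow \<C> - {{}})} (Pow \<C> - {{}})"
    using bij_betw_from_nat_into_finite by blast
  define m where "m = card (Pow \<C> - {{}})"
  define D where "D j = {x\<in>space M. {C\<in>\<C>. x \<in> C} = h j}" for j
  define J where "J C = {j\<in>{..<m}. C \<in> h j}" for C
  have hm: "h j \<subseteq> \<C>" "h j \<noteq> {}" if "j < m" for j
    using bij_betwE[OF h] that by (auto simp: m_def)
  show thesis
  proof (rule that[of D m J])
    show "disjoint_family_on D {..<m}"
    proof (unfold disjoint_family_on_def, intro ballI impI)
      fix i j assume "i \<in> {..<m}" "j \<in> {..<m}" "i \<noteq> j"
      then have "h i \<noteq> h j"
        using bij_betw_imp_inj_on[OF h] unfolding m_def by (metis inj_onD)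
      then show "D i \<inter> D j = {}"
        unfolding D_def by blast
    qed
    show "D j \<in> sets M" if "j < m" for j
    proof -
      have "D j = {x\<in>space M. \<forall>C\<in>\<C>. x \<in> C \<longleftrightarrow> C \<in> h j}"
        using hm[OF that] by (auto simp: D_def)
      also have "\<dots> \<in> sets M"
        using assms by (intro sets.sets_Collect_finite_All sets.sets_Collect) auto
      finally show ?thesis .
    qed
    show "\<exists>C\<in>\<C>. D j \<subseteq> C" if "j < m" for j
    proof -
      obtain C where "C \<in> h j" "C \<in> \<C>"
        using hm[OF \<open>j < m\<close>] by blast
      moreover have "D j \<subseteq> C"
      proof
        fix x assume "x \<in> D j"
        then have "{C\<in>\<C>. x \<in> C} = h j"
          by (simp add: D_def)
        then show "x \<in> C"
          using \<open>C \<in> h j\<close> by blast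
      qed
      ultimately show ?thesis
        by blast
    qed
    show "J C \<subseteq> {..<m}" for C
      by (auto simp: J_def)
    show "C = (\<Union>j\<in>J C. D j)" if C: "C \<in> \<C>" for C
    proof
      show "(\<Union>j\<in>J C. D j) \<subseteq> C"
      proof
        fix x assume "x \<in> (\<Union>j\<in>J C. D j)"
        then obtain j where "C \<in> h j" "{C\<in>\<C>. x \<in> C} = h j"
          by (auto simp: D_def J_def)
        then show "x \<in> C"
          by blast
      qed
      show "C \<subseteq> (\<Union>j\<in>J C. D j)"
      proof
        fix x assume x: "x \<in> C"
        then have "{C\<in>\<C>. x \<in> C} \<noteq> {}"
          using C by blast
        then have "{C\<in>\<C>. x \<in> C} \<in> h ` {..<m}"
          unfolding m_def bij_betw_imp_surj_on[OF h] by blast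
        then obtain j where "{C\<in>\<C>. x \<in> C} = h j" "j \<in> {..<m}"
          by (rule imageE)
        then have "j < m" "{C\<in>\<C>. x \<in> C} = h j"
          by simp_all
        moreover have "x \<in> space M"
          using x C assms(2) sets.sets_into_space by blast
        moreover have "C \<in> h j"
          unfolding \<open>{C\<in>\<C>. x \<in> C} = h j\<close>[symmetric] using x C by blast
        ultimately have "j \<in> J C" "x \<in> D j"
          by (simp_all add: J_def D_def)
        then show "x \<in> (\<Union>j\<in>J C. D j)"
          by blast
      qed
    qed
  qed
qed

section \<open>Events of prescribed counts and the sigma-field they generate\<close>

lemma sets_counting_algebra_counts:
  assumes "\<And>j. j < (m :: nat) \<Longrightarrow> D j \<in> sets L"
  shows "{\<nu>\<in>counting_measures L. \<forall>j<m. emeasure \<nu> (D j) = of_nat (n j)} \<in> sets (counting_algebra L)"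
proof -
  have "{\<nu>\<in>counting_measures L. \<forall>j<m. emeasure \<nu> (D j) = of_nat (n j)} =
      {\<nu>\<in>space (counting_algebra L). \<forall>j\<in>{..<m}. emeasure \<nu> (D j) = of_nat (n j)}"
    by (auto simp: space_counting_algebra)
  also have "\<dots> \<in> sets (counting_algebra L)"
  proof (rule sets.sets_Collect_finite_All)
    fix j assume "j \<in> {..<m}"
    then have "(\<lambda>\<nu>. emeasure \<nu> (D j)) \<in> borel_measurable (counting_algebra L)"
      using assms by (intro measurable_emeasure_counting_algebra) simp
    then show "{\<nu>\<in>space (counting_algebra L). emeasure \<nu> (D j) = of_nat (n j)} \<in> sets (counting_algebra L)"
      by measurable
  qed simp
  finally show ?thesis .
qed

text \<open>The prescription is a set of pairs rather than a function, so that intersecting two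
  cylinders means uniting their index sets, even when these prescribe different counts for the same
  set.\<close>

definition cylinder :: "'a measure \<Rightarrow> ('a set \<times> nat) set \<Rightarrow> 'a measure set" where
  "cylinder L R = {\<nu>\<in>counting_measures L. \<forall>(C, k)\<in>R. emeasure \<nu> C = of_nat k}"

definition finite_sets :: "'a measure \<Rightarrow> 'a set set" where
  "finite_sets L = {C\<in>sets L. emeasure L C < \<infinity>}"

lemma finite_setsD:
  assumes "C \<in> finite_sets L"
  shows "C \<in> sets L" "emeasure L C < \<infinity>"
  using assms by (auto simp: finite_sets_def)

text \<open>Counts are extended naturals, so for a set of finite intensity the evaluation is
  determined by its countably many finite levels, each of which is a cylinder. Any other evaluation
  is an increasing limit of these along an exhaustion of the space by sets of finite
  intensity.\<close>

lemma sets_counting_algebra_eq_cylinders: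
  assumes "sigma_finite_measure L"
  shows "sets (counting_algebra L) =
    sigma_sets (counting_measures L) (cylinder L ` {R. finite R \<and> R \<subseteq> finite_sets L \<times> UNIV})"
    (is "_ = sigma_sets ?N (_ ` ?R)")
proof
  interpret sigma_finite_measure L by fact
  let ?S = "sigma ?N (cylinder L ` ?R)"
  have sub: "cylinder L ` ?R \<subseteq> Pow ?N"
    by (auto simp: cylinder_def)
  have sp: "space ?S = ?N"
    using sub by (simp add: space_measure_of)
  have sets_S: "sets ?S = sigma_sets ?N (cylinder L ` ?R)"
    using sub by simp
  have fin: "(\<lambda>\<nu>. emeasure \<nu> C) \<in> borel_measurable ?S" if C: "C \<in> finite_sets L" for C
  proof -
    have lvl: "{\<nu>\<in>space ?S. emeasure \<nu> C = of_nat k} \<in> sets ?S" for k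
    proof -
      have "{\<nu>\<in>space ?S. emeasure \<nu> C = of_nat k} = cylinder L {(C, k)}"
        unfolding sp by (auto simp: cylinder_def)
      then show ?thesis
        unfolding sets_S using C by (auto intro!: sigma_sets.Basic)
    qed
    have [measurable]: "Measurable.pred ?S (\<lambda>\<nu>. emeasure \<nu> C = of_nat k)" for k
      using lvl[of k] by (simp add: pred_def)
    \<comment> \<open>\<open>top\<close> is the one value of the count that no cylinder prescribes;
      \<open>LEAST\<close> merely names the unique \<open>k\<close>.\<close>
    have "(\<lambda>\<nu>. if \<exists>k. emeasure \<nu> C = of_nat k then of_nat (LEAST k. emeasure \<nu> C = of_nat k) else top :: ennreal)
        \<in> borel_measurable ?S"
      by measurable
    also have "?this \<longleftrightarrow> ?thesis"
    proof (rule measurable_cong)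
      fix \<nu> assume "\<nu> \<in> space ?S"
      then have \<nu>: "\<nu> \<in> ?N"
        unfolding sp .
      have "C \<in> sets L"
        using C by (simp add: finite_sets_def)
      then obtain n where n: "emeasure \<nu> C = ennreal_of_enat n"
        using counting_measuresD(4)[OF \<nu>] by blast
      show "(if \<exists>k. emeasure \<nu> C = of_nat k then of_nat (LEAST k. emeasure \<nu> C = of_nat k) else top) = emeasure \<nu> C"
        by (cases n) (auto simp: n intro!: Least_equality)
    qed
    finally show ?thesis .
  qed
  obtain A :: "nat \<Rightarrow> 'a set" where A: "range A \<subseteq> sets L" "(\<Union>i. A i) = space L"
    "\<And>i. emeasure L (A i) \<noteq> \<infinity>" "incseq A"
    by (rule sigma_finite_incseq) blast
  have id: "(\<lambda>\<nu>. \<nu>) \<in> ?S \<rightarrow>\<^sub>M counting_algebra L"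
  proof (rule measurable_counting_algebraI)
    show "(\<lambda>\<nu>. emeasure \<nu> B) \<in> borel_measurable ?S" if B: "B \<in> sets L" for B
    proof -
      have BA: "B \<inter> A i \<in> finite_sets L" for i
        using A B le_less_trans[OF emeasure_mono[of "B \<inter> A i" "A i" L]]
        by (auto simp: finite_sets_def less_top)
      have inc: "incseq (\<lambda>i. B \<inter> A i)"
        by (rule incseq_SucI) (use incseq_SucD[OF A(4)] in blast)
      have "(\<lambda>\<nu>. SUP i. emeasure \<nu> (B \<inter> A i)) \<in> borel_measurable ?S"
        by (intro borel_measurable_SUP fin BA) auto
      also have "?this \<longleftrightarrow> ?thesis"
      proof (rule measurable_cong)
        fix \<nu> assume "\<nu> \<in> space ?S"
        then have s: "sets \<nu> = sets L"
          unfolding sp by (rule counting_measuresD)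
        have "(SUP i. emeasure \<nu> (B \<inter> A i)) = emeasure \<nu> (\<Union>i. B \<inter> A i)"
          using A B by (intro SUP_emeasure_incseq inc) (auto simp: s)
        also have "(\<Union>i. B \<inter> A i) = B"
          using A(2) sets.sets_into_space[OF B] by auto
        finally show "(SUP i. emeasure \<nu> (B \<inter> A i)) = emeasure \<nu> B" .
      qed
      finally show ?thesis .
    qed
  qed (simp only: sp)
  show "sets (counting_algebra L) \<subseteq> sigma_sets ?N (cylinder L ` ?R)"
  proof
    fix X assume X: "X \<in> sets (counting_algebra L)"
    then have "X \<subseteq> ?N"
      using sets.sets_into_space[OF X] by (simp add: space_counting_algebra)
    then have "(\<lambda>\<nu>. \<nu>) -` X \<inter> space ?S = X"
      unfolding sp by blast
    then show "X \<in> sigma_sets ?N (cylinder L ` ?R)"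
      using measurable_sets[OF id X] unfolding sets_S by (simp only:)
  qed
  have "cylinder L R \<in> sets (counting_algebra L)" if R: "R \<in> ?R" for R
  proof -
    have "cylinder L R = {\<nu>\<in>space (counting_algebra L). \<forall>p\<in>R. emeasure \<nu> (fst p) = of_nat (snd p)}"
      unfolding cylinder_def space_counting_algebra by (simp add: split_beta')
    also have "\<dots> \<in> sets (counting_algebra L)"
    proof (rule sets.sets_Collect_finite_All)
      fix p assume "p \<in> R"
      then have [measurable]: "fst p \<in> sets L"
        using R by (auto simp: finite_sets_def)
      show "{\<nu>\<in>space (counting_algebra L). emeasure \<nu> (fst p) = of_nat (snd p)} \<in> sets (counting_algebra L)"
        by measurable
    qed (use R in auto)
    finally show ?thesis .
  qed
  then show "sigma_sets ?N (cylinder L ` ?R) \<subseteq> sets (counting_algebra L)"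
    using sets.sigma_sets_subset[of "cylinder L ` ?R" "counting_algebra L"]
    unfolding space_counting_algebra by blast
qed

lemma emeasure_UN_atoms:
  assumes \<nu>: "\<nu> \<in> counting_measures L" and "finite J" "disjoint_family_on D J"
    "\<And>j. j \<in> J \<Longrightarrow> D j \<in> sets L"
  shows "emeasure \<nu> (\<Union>j\<in>J. D j) = (\<Sum>j\<in>J. emeasure \<nu> (D j))"
  using assms by (intro sum_emeasure[symmetric]) (auto simp: counting_measuresD)

text \<open>
  A cylinder is, up to a null set, the countable disjoint union of the events fixing the counts of the
  atoms generated by \<open>B\<close> and the sets occurring in it.
\<close>

lemma measure_eqI_counts:
  assumes L: "sigma_finite_measure L" and B: "B \<in> finite_sets L"
    and sets: "sets M1 = sets (counting_algebra L)" "sets M2 = sets (counting_algebra L)"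
    and fin: "finite_measure M2"
    and AE1: "\<And>C. C \<in> finite_sets L \<Longrightarrow> AE \<nu> in M1. emeasure \<nu> C < \<infinity>"
    and AE2: "\<And>C. C \<in> finite_sets L \<Longrightarrow> AE \<nu> in M2. emeasure \<nu> C < \<infinity>"
    and eq: "\<And>m D n J. disjoint_family_on D {..<m} \<Longrightarrow> (\<And>j. j < m \<Longrightarrow> D j \<in> finite_sets L) \<Longrightarrow>
      J \<subseteq> {..<m} \<Longrightarrow> B = (\<Union>j\<in>J. D j) \<Longrightarrow>
      emeasure M1 {\<nu>\<in>counting_measures L. \<forall>j<m. emeasure \<nu> (D j) = of_nat (n j)} =
      emeasure M2 {\<nu>\<in>counting_measures L. \<forall>j<m. emeasure \<nu> (D j) = of_nat (n (j::nat))}"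
  shows "M1 = M2"
proof -
  let ?R = "{R. finite R \<and> R \<subseteq> finite_sets L \<times> (UNIV :: nat set)}"
  have key: "emeasure M1 X = emeasure M2 X"
    if X: "X = cylinder L R" and R: "finite R" "R \<subseteq> finite_sets L \<times> UNIV" for X R
  proof -
    \<comment> \<open>\<open>B\<close> joins the sets of the cylinder so that it, too, becomes a
      union of atoms, as \<open>eq\<close> demands.\<close>
    have \<C>_fin: "insert B (fst ` R) \<subseteq> finite_sets L"
      using B R(2) by auto
    then have \<C>_sets: "insert B (fst ` R) \<subseteq> sets L"
      unfolding finite_sets_def by blast
    have \<C>_finite: "finite (insert B (fst ` R))"
      using R(1) by simp
    obtain m :: nat and D J where D: "disjoint_family_on D {..<m}" "\<And>j. j < m \<Longrightarrow> D j \<in> sets L"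
      "\<And>j. j < m \<Longrightarrow> \<exists>C\<in>insert B (fst ` R). D j \<subseteq> C"
      and J: "\<And>C. C \<in> insert B (fst ` R) \<Longrightarrow> J C \<subseteq> {..<m}"
      "\<And>C. C \<in> insert B (fst ` R) \<Longrightarrow> C = (\<Union>j\<in>J C. D j)"
    proof (rule finite_atoms[OF \<C>_finite \<C>_sets], goal_cases)
      case (1 m D J)
      show ?case
        by (rule 1(1)) (rule 1(2) | erule 1(3-6))+
    qed
    have Dfin: "D j \<in> finite_sets L" if j: "j < m" for j
    proof -
      obtain C where "C \<in> finite_sets L" "D j \<subseteq> C"
        using D(3)[OF j] \<C>_fin by blast
      then show ?thesis
        using D(2)[OF j] emeasure_mono[of "D j" C L] by (auto simp: finite_sets_def intro: le_less_trans)
    qed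
    \<comment> \<open>The count vectors compatible with \<open>R\<close>. As they are extensional,
      distinct ones differ at some \<open>j < m\<close>, which makes the events \<open>E n\<close>
      disjoint; finitely many coordinates in the naturals make \<open>T\<close> countable.\<close>
    define T where "T = {n\<in>Pi\<^sub>E {..<m} (\<lambda>_. UNIV :: nat set). \<forall>(C, k)\<in>R. (\<Sum>j\<in>J C. n j) = k}"
    define E where "E n = {\<nu>\<in>counting_measures L. \<forall>j<m. emeasure \<nu> (D j) = of_nat (n j)}" for n :: "nat \<Rightarrow> nat"
    have E_sets: "E n \<in> sets (counting_algebra L)" for n
      unfolding E_def by (rule sets_counting_algebra_counts[OF D(2)])
    have T_count: "countable T"
      unfolding T_def by (rule countable_subset[OF _ countable_PiE[of "{..<m}"]]) auto
    have E_disj: "disjoint_family_on E T"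
    proof (unfold disjoint_family_on_def, intro ballI impI)
      fix n n' assume "n \<in> T" "n' \<in> T" "n \<noteq> n'"
      then have "n \<in> Pi\<^sub>E {..<m} (\<lambda>_. UNIV)" "n' \<in> Pi\<^sub>E {..<m} (\<lambda>_. UNIV)"
        by (simp_all add: T_def)
      from PiE_ext[OF this] obtain j where "j < m" "n j \<noteq> n' j"
        using \<open>n \<noteq> n'\<close> by blast
      then show "E n \<inter> E n' = {}"
        by (auto simp: E_def)
    qed
    have cyl: "\<nu> \<in> cylinder L R \<longleftrightarrow> \<nu> \<in> (\<Union>n\<in>T. E n)"
      if \<nu>: "\<nu> \<in> counting_measures L" and finD: "\<forall>j<m. emeasure \<nu> (D j) < \<infinity>" for \<nu>
    proof -
      have "\<exists>k. emeasure \<nu> (D j) = of_nat k" if j: "j < m" for j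
      proof -
        obtain e where "emeasure \<nu> (D j) = ennreal_of_enat e"
          using counting_measuresD(4)[OF \<nu> D(2)[OF j]] by auto
        then show ?thesis using finD j by (cases e) auto
      qed
      then obtain n where n: "\<And>j. j < m \<Longrightarrow> emeasure \<nu> (D j) = of_nat (n j)"
        by metis
      have sum: "emeasure \<nu> C = of_nat (\<Sum>j\<in>J C. n' j)"
        if "(C, k) \<in> R" "\<And>j. j < m \<Longrightarrow> emeasure \<nu> (D j) = of_nat (n' j)" for C k n'
      proof -
        have C: "C \<in> insert B (fst ` R)"
          using that(1) by force
        note JC = J[OF C]
        have "emeasure \<nu> C = emeasure \<nu> (\<Union>j\<in>J C. D j)"
          by (rule arg_cong[OF JC(2)])
        also have "\<dots> = (\<Sum>j\<in>J C. emeasure \<nu> (D j))"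
        proof (rule emeasure_UN_atoms[OF \<nu>])
          show "disjoint_family_on D (J C)"
            by (rule disjoint_family_on_mono[OF JC(1) D(1)])
        qed (use JC(1) D(2) finite_subset[OF JC(1)] in auto)
        also have "\<dots> = (\<Sum>j\<in>J C. of_nat (n' j))"
          using JC(1) that(2) by (intro sum.cong) auto
        finally show ?thesis by simp
      qed
      show ?thesis
      proof
        assume "\<nu> \<in> cylinder L R"
        have "(\<Sum>j\<in>J C. restrict n {..<m} j) = k" if Ck: "(C, k) \<in> R" for C k
        proof -
          have "emeasure \<nu> C = of_nat k"
            using \<open>\<nu> \<in> cylinder L R\<close> Ck unfolding cylinder_def by blast
          then have "(\<Sum>j\<in>J C. n j) = k"
            using sum[OF Ck n] by (simp only: of_nat_eq_iff)
          moreover have "J C \<subseteq> {..<m}"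
            using Ck by (intro J(1)) force
          then have "(\<Sum>j\<in>J C. restrict n {..<m} j) = (\<Sum>j\<in>J C. n j)"
            by (intro sum.cong) auto
          ultimately show ?thesis
            by simp
        qed
        then have "\<forall>(C, k)\<in>R. (\<Sum>j\<in>J C. restrict n {..<m} j) = k"
          by blast
        then have "restrict n {..<m} \<in> T"
          unfolding T_def by (intro CollectI conjI) auto
        moreover have "\<nu> \<in> E (restrict n {..<m})"
          using \<nu> n by (auto simp: E_def)
        ultimately show "\<nu> \<in> (\<Union>n\<in>T. E n)" by blast
      next
        assume "\<nu> \<in> (\<Union>n\<in>T. E n)"
        then obtain n' where "n' \<in> T" and n': "\<And>j. j < m \<Longrightarrow> emeasure \<nu> (D j) = of_nat (n' j)"
          by (auto simp: E_def)
        have "emeasure \<nu> C = of_nat k" if Ck: "(C, k) \<in> R" for C k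
        proof -
          have "(\<Sum>j\<in>J C. n' j) = k"
            using \<open>n' \<in> T\<close> Ck by (auto simp: T_def)
          then show ?thesis
            using sum[OF Ck n'] by (simp only:)
        qed
        then show "\<nu> \<in> cylinder L R"
          using \<nu> unfolding cylinder_def by blast
      qed
    qed
    have X_sum: "emeasure M X = (\<integral>\<^sup>+n. emeasure M (E n) \<partial>count_space T)"
      if sM: "sets M = sets (counting_algebra L)" and AE: "\<And>C. C \<in> finite_sets L \<Longrightarrow> AE \<nu> in M. emeasure \<nu> C < \<infinity>"
      for M
    proof -
      have "AE \<nu> in M. \<forall>j\<in>{..<m}. emeasure \<nu> (D j) < \<infinity>"
        using Dfin by (intro AE_finite_allI AE) auto
      then have "emeasure M X = emeasure M (\<Union>n\<in>T. E n)"
      proof (intro emeasure_eq_AE, goal_cases)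
        case 1
        then show ?case
          using AE_space
        proof eventually_elim
          case (elim \<nu>)
          then have "\<nu> \<in> counting_measures L"
            using sets_eq_imp_space_eq[OF sM] by (simp add: space_counting_algebra)
          moreover have "\<forall>j<m. emeasure \<nu> (D j) < \<infinity>"
            using elim(1) by simp
          ultimately show ?case
            unfolding X by (rule cyl)
        qed
      next
        case 2
        show ?case unfolding sM X sets_counting_algebra_eq_cylinders[OF L]
          using R by (intro sigma_sets.Basic) auto
      next
        case 3
        show ?case unfolding sM using T_count E_sets by (intro sets.countable_UN'') auto
      qed
      also have "\<dots> = (\<integral>\<^sup>+n. emeasure M (E n) \<partial>count_space T)"
        using T_count E_disj E_sets by (intro emeasure_UN_countable) (auto simp: sM)
      finally show ?thesis .
    qed
    have "emeasure M1 (E n) = emeasure M2 (E n)" for n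
      unfolding E_def using J[of B] by (intro eq[OF D(1) Dfin, of "J B"]) auto
    then show ?thesis
      using X_sum[OF sets(1) AE1] X_sum[OF sets(2) AE2] by simp
  qed
  show ?thesis
  proof (rule measure_eqI_generator_eq)
    show "sets M1 = sigma_sets (counting_measures L) (cylinder L ` ?R)"
      "sets M2 = sigma_sets (counting_measures L) (cylinder L ` ?R)"
      using sets sets_counting_algebra_eq_cylinders[OF L] by auto
    show "Int_stable (cylinder L ` ?R)"
    proof (rule Int_stableI)
      fix a b assume "a \<in> cylinder L ` ?R" "b \<in> cylinder L ` ?R"
      then obtain R1 R2 where "a = cylinder L R1" "b = cylinder L R2" "R1 \<in> ?R" "R2 \<in> ?R"
        by blast
      then have "a \<inter> b = cylinder L (R1 \<union> R2)" "R1 \<union> R2 \<in> ?R"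
        by (auto simp: cylinder_def)
      then show "a \<inter> b \<in> cylinder L ` ?R" by blast
    qed
    \<comment> \<open>The whole space is the cylinder without prescriptions, so \<open>key\<close>
      also transfers finiteness from \<open>M2\<close> to \<open>M1\<close>.\<close>
    have \<Omega>: "counting_measures L = cylinder L {}"
      by (auto simp: cylinder_def)
    then show "range (\<lambda>_::nat. counting_measures L) \<subseteq> cylinder L ` ?R"
      by blast
    show "emeasure M1 (counting_measures L) \<noteq> \<infinity>"
      using key[OF \<Omega>] finite_measure.emeasure_finite[OF fin] by simp
    show "emeasure M1 X = emeasure M2 X" if "X \<in> cylinder L ` ?R" for X
      using that key by blast
  qed (auto simp: cylinder_def)
qed

subsection \<open>Truncation and restriction\<close>

definition clamp_real :: "real \<Rightarrow> real \<Rightarrow> real" where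
  "clamp_real k r = max (- k) (min k r)"

lemma clamp_real_measurable [measurable]: "clamp_real k \<in> borel_measurable borel"
  unfolding clamp_real_def by measurable

lemma abs_clamp_real_le: "0 \<le> k \<Longrightarrow> \<bar>clamp_real k r\<bar> \<le> k"
  by (auto simp: clamp_real_def)

lemma abs_clamp_real_diff_le: "\<bar>clamp_real k r - clamp_real k s\<bar> \<le> \<bar>r - s\<bar>"
  by (auto simp: clamp_real_def)

lemma clamp_real_square_le:
  assumes "0 \<le> k"
  shows "(clamp_real k r)\<^sup>2 \<le> r * clamp_real k r"
proof -
  consider "r < - k" | "- k \<le> r" "r \<le> k" | "k < r" by linarith
  then show ?thesis
  proof cases
    case 1
    then have "clamp_real k r = - k" using assms by (simp add: clamp_real_def)
    then show ?thesis using 1 assms mult_right_mono_neg[of r "- k" "- k"] by (simp add: power2_eq_square)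
  next
    case 2
    then show ?thesis by (simp add: clamp_real_def power2_eq_square)
  next
    case 3
    then have "clamp_real k r = k" using assms by (simp add: clamp_real_def)
    then show ?thesis using 3 assms mult_right_mono[of k r k] by (simp add: power2_eq_square)
  qed
qed

lemma clamp_real_square_mono: "0 \<le> k \<Longrightarrow> k \<le> l \<Longrightarrow> (clamp_real k r)\<^sup>2 \<le> (clamp_real l r)\<^sup>2"
  unfolding abs_le_square_iff[symmetric] by (auto simp: clamp_real_def)

lemma clamp_real_eq: "\<bar>r\<bar> \<le> k \<Longrightarrow> clamp_real k r = r"
  by (auto simp: clamp_real_def)

section \<open>Integrals with respect to restricted measures and measures with an added
  point\<close>

lemma nn_integral_density_indicator_le:
  assumes "A \<in> sets M" "f \<in> borel_measurable M"
  shows "(\<integral>\<^sup>+x. f x \<partial>density M (indicator A)) \<le> (\<integral>\<^sup>+x. f x \<partial>M)"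
  using assms by (subst nn_integral_density) (auto intro!: nn_integral_mono simp: indicator_def)

lemma nn_integral_add_point:
  assumes x: "x \<in> space \<nu>" and f: "f \<in> borel_measurable \<nu>"
  shows "(\<integral>\<^sup>+y. f y \<partial>add_point \<nu> x) = f x + (\<integral>\<^sup>+y. f y \<partial>\<nu>)"
  using f
proof (induction rule: borel_measurable_induct)
  case (cong f g)
  have sp: "space (add_point \<nu> x) = space \<nu>"
    by (rule sets_eq_imp_space_eq) simp
  have "(\<integral>\<^sup>+y. f y \<partial>add_point \<nu> x) = (\<integral>\<^sup>+y. g y \<partial>add_point \<nu> x)"
    by (rule nn_integral_cong) (simp add: sp cong(3))
  moreover have "(\<integral>\<^sup>+y. f y \<partial>\<nu>) = (\<integral>\<^sup>+y. g y \<partial>\<nu>)"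
    by (rule nn_integral_cong) (simp add: cong(3))
  ultimately show ?case
    using cong.IH cong(3)[OF x] by (simp only:)
next
  case (set A)
  then show ?case
    using emeasure_add_point[OF set, of x] by (simp add: add.commute)
next
  case (mult u c)
  then show ?case
    by (simp add: nn_integral_cmult distrib_left measurable_cong_sets[OF sets_add_point refl])
next
  case (add u v)
  then show ?case
    by (simp add: nn_integral_add ac_simps measurable_cong_sets[OF sets_add_point refl])
next
  case (seq U)
  then have "(\<integral>\<^sup>+y. (SUP i. U i) y \<partial>add_point \<nu> x) = (SUP i. U i x + (\<integral>\<^sup>+y. U i y \<partial>\<nu>))"
    by (simp add: nn_integral_monotone_convergence_SUP measurable_cong_sets[OF sets_add_point refl] image_comp)
  also have "\<dots> = (SUP i. U i x) + (SUP i. \<integral>\<^sup>+y. U i y \<partial>\<nu>)"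
    using seq(3) by (intro ennreal_SUP_add) (auto simp: incseq_def le_fun_def intro!: nn_integral_mono)
  also have "(SUP i. \<integral>\<^sup>+y. U i y \<partial>\<nu>) = (\<integral>\<^sup>+y. (SUP i. U i) y \<partial>\<nu>)"
    using seq by (simp add: nn_integral_monotone_convergence_SUP image_comp)
  finally show ?case
    by (simp add: image_comp)
qed

text \<open>
  \<open>\<nu>\<close> restricted to \<open>A\<close>; the value when \<open>\<nu>(A) = \<infinity>\<close> is immaterial, as this happens with
  probability \<open>0\<close> for the sets \<open>A\<close> considered, and is chosen so that all values are finite measures.
\<close>

definition trace_measure :: "'a set \<Rightarrow> 'a measure \<Rightarrow> 'a measure" where
  "trace_measure A \<nu> = (if emeasure \<nu> A < \<infinity> then density \<nu> (indicator A) else null_measure \<nu>)"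

lemma sets_trace_measure [simp]: "sets (trace_measure A \<nu>) = sets \<nu>"
  by (simp add: trace_measure_def)

lemma emeasure_trace_measure:
  assumes "A \<in> sets \<nu>" "C \<in> sets \<nu>"
  shows "emeasure (trace_measure A \<nu>) C = (if emeasure \<nu> A < \<infinity> then emeasure \<nu> (A \<inter> C) else 0)"
proof -
  have "(\<integral>\<^sup>+x. indicator A x * indicator C x \<partial>\<nu>) = (\<integral>\<^sup>+x. indicator (A \<inter> C) x \<partial>\<nu>)"
    by (intro nn_integral_cong) (simp add: indicator_inter_arith)
  then show ?thesis
    using assms by (simp add: trace_measure_def emeasure_density)
qed

lemma finite_trace_measure:
  assumes "A \<in> sets \<nu>"
  shows "finite_measure (trace_measure A \<nu>)"
proof (rule finite_measureI)
  have "space (trace_measure A \<nu>) = space \<nu>"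
    by (rule sets_eq_imp_space_eq) simp
  then show "emeasure (trace_measure A \<nu>) (space (trace_measure A \<nu>)) \<noteq> \<infinity>"
    using assms sets.sets_into_space[OF assms] by (auto simp: emeasure_trace_measure Int_absorb2)
qed

subsection \<open>The Mecke formula for the Poisson process\<close>

definition poisson_weight :: "real \<Rightarrow> nat \<Rightarrow> real" where
  "poisson_weight l k = l ^ k / fact k * exp (- l)"

lemma poisson_weight_nonneg: "0 \<le> l \<Longrightarrow> 0 \<le> poisson_weight l k"
  by (simp add: poisson_weight_def)

text \<open>The Mecke formula for a single Poisson variable; the formula for the process is reduced
  to it.\<close>

lemma poisson_weight_Suc: "real (Suc k) * poisson_weight l (Suc k) = l * poisson_weight l k"
  by (simp add: poisson_weight_def del: of_nat_Suc)

lemma poisson_weight_sums: "poisson_weight l sums 1"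
proof -
  have "(\<lambda>k. l ^ k / fact k * exp (- l)) sums (exp l * exp (- l))"
    using exp_converges[of l] by (intro sums_mult2) (simp add: field_simps scaleR_conv_of_real)
  then show ?thesis
    by (simp add: poisson_weight_def[abs_def] exp_minus)
qed

text \<open>The law of the process in place of the process: sample points are now the configurations
  themselves, so that adding a point maps the sample space to itself, as \<open>mecke_space\<close>
  requires. The Poisson marginals and the independence are merged into one product formula for
  disjoint sets of finite intensity.\<close>

locale poisson_law = prob_space Q for Q :: "'a measure measure" +
  fixes L :: "'a measure"
  assumes sigma_finite: "sigma_finite_measure L"
    and sets_Q: "sets Q = sets (counting_algebra L)"
    and counts: "\<And>(m :: nat) D n. disjoint_family_on D {..<m} \<Longrightarrow>
      (\<And>j. j < m \<Longrightarrow> D j \<in> finite_sets L) \<Longrightarrow>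
      measure Q {\<nu>\<in>counting_measures L. \<forall>j<m. emeasure \<nu> (D j) = of_nat (n j)} =
        (\<Prod>j<m. poisson_weight (measure L (D j)) (n j))"
begin

sublocale L: sigma_finite_measure L
  by (rule sigma_finite)

sublocale QL: pair_sigma_finite Q L
  by unfold_locales

lemma measurable_Q: "measurable Q M = measurable (counting_algebra L) M"
  "measurable M Q = measurable M (counting_algebra L)"
  by (rule measurable_cong_sets, simp_all add: sets_Q)+

lemma measurable_fst_Q [measurable]: "fst \<in> Q \<Otimes>\<^sub>M M \<rightarrow>\<^sub>M counting_algebra L"
  using measurable_fst[of Q M] unfolding measurable_Q .

lemma measurable_id_Q [measurable]: "(\<lambda>\<nu>. \<nu>) \<in> Q \<rightarrow>\<^sub>M counting_algebra L"
  by (rule measurable_ident_sets[OF sets_Q])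

lemma space_Q: "space Q = counting_measures L"
  using sets_eq_imp_space_eq[OF sets_Q] by (simp add: space_counting_algebra)

lemma sets_counts:
  assumes "\<And>j. j < (m :: nat) \<Longrightarrow> D j \<in> finite_sets L"
  shows "{\<nu>\<in>counting_measures L. \<forall>j<m. emeasure \<nu> (D j) = of_nat (n j)} \<in> sets Q"
  unfolding sets_Q by (rule sets_counting_algebra_counts[OF finite_setsD(1)[OF assms]])

lemma measurable_shift: "(\<lambda>p. add_point (fst p) (snd p)) \<in> Q \<Otimes>\<^sub>M L \<rightarrow>\<^sub>M Q"
  unfolding measurable_Q by (rule measurable_add_point[OF measurable_fst_Q measurable_snd])

lemma measurable_count: "C \<in> sets L \<Longrightarrow> (\<lambda>\<nu>. emeasure \<nu> C) \<in> borel_measurable Q"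
  by (rule measurable_emeasure_counting_algebra'[OF measurable_id_Q])

text \<open>The Poisson weights sum to 1, which leaves no probability for an infinite count.\<close>

lemma AE_finite_counts:
  assumes C: "C \<in> finite_sets L"
  shows "AE \<nu> in Q. emeasure \<nu> C < \<infinity>"
proof -
  define E where "E k = {\<nu>\<in>counting_measures L. emeasure \<nu> C = of_nat k}" for k :: nat
  have E: "E k \<in> sets Q" "measure Q (E k) = poisson_weight (measure L C) k" for k
    using sets_counts[of 1 "\<lambda>_. C" "\<lambda>_. k"] counts[of "\<lambda>_. C" 1 "\<lambda>_. k"] C
    by (simp_all add: E_def disjoint_family_on_def)
  have "(\<lambda>k. measure Q (E k)) sums measure Q (\<Union>k. E k)"
    using E by (intro finite_measure_UNION) (auto simp: disjoint_family_on_def E_def)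
  then have "prob (\<Union>k. E k) = 1"
    using sums_unique2[OF _ poisson_weight_sums] by (simp add: E)
  then have "AE \<nu> in Q. \<nu> \<in> (\<Union>k. E k)"
    using E by (subst (asm) prob_eq_1) auto
  then show ?thesis
    by eventually_elim (auto simp: E_def less_top[symmetric])
qed

text \<open>On \<open>E\<close> the count of \<open>B\<close> is the sum of the \<open>n j\<close>
  over \<open>J\<close>, while a point added in \<open>D j\<close> leads into \<open>E\<close>
  exactly from the event in which \<open>n j\<close> is lowered by one. By the product form of the
  probabilities the identity then reduces, for each \<open>j\<close>, to
  \<open>poisson_weight_Suc\<close>.\<close>

lemma mecke_counts:
  fixes n :: "nat \<Rightarrow> nat"
  assumes D: "disjoint_family_on D {..<m}" "\<And>j. j < m \<Longrightarrow> D j \<in> finite_sets L"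
    and J: "J \<subseteq> {..<m}" and B: "B = (\<Union>j\<in>J. D j)"
  defines "E \<equiv> {\<nu>\<in>counting_measures L. \<forall>j<m. emeasure \<nu> (D j) = of_nat (n j)}"
  shows "(\<integral>\<^sup>+\<nu>. emeasure \<nu> B * indicator E \<nu> \<partial>Q) =
    (\<integral>\<^sup>+x. emeasure Q {\<nu>\<in>space Q. add_point \<nu> x \<in> E} * indicator B x \<partial>L)"
proof -
  have Dsets [measurable]: "D j \<in> sets L" if "j < m" for j
    using D(2)[OF that] by (simp add: finite_sets_def)
  have fJ: "finite J"
    using J by (rule finite_subset) simp
  have E: "E \<in> sets Q"
    unfolding E_def by (rule sets_counts[OF D(2)])
  define p where "p n = (\<Prod>j<m. poisson_weight (measure L (D j)) (n j))" for n
  \<comment> \<open>The probability that a point added in \<open>D j\<close> leads into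
    \<open>E\<close>. The case \<open>n j = 0\<close> is separate because truncated subtraction
    would give \<open>p n\<close> instead of 0.\<close>
  define c where "c j = (if n j = 0 then 0 else p (n(j := n j - 1)))" for j
  have p_nonneg: "0 \<le> p n" for n
    unfolding p_def by (intro prod_nonneg poisson_weight_nonneg) auto
  have emE: "emeasure Q {\<nu>\<in>counting_measures L. \<forall>j<m. emeasure \<nu> (D j) = of_nat (n j)} = ennreal (p n)" for n
    using counts[OF D] by (simp add: emeasure_eq_measure p_def)
  have term_eq: "real (n j) * p n = measure L (D j) * c j" if j: "j < m" for j
  proof (cases "n j")
    case (Suc k)
    have "p n' = poisson_weight (measure L (D j)) (n' j) *
        (\<Prod>i\<in>{..<m} - {j}. poisson_weight (measure L (D i)) (n' i))" for n'
      unfolding p_def using j by (intro prod.remove) auto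
    from this[of n] this[of "n(j := k)"] show ?thesis
      using poisson_weight_Suc[of k "measure L (D j)"] by (simp add: c_def Suc mult.assoc[symmetric])
  qed (simp add: c_def)
  have shifted: "emeasure Q {\<nu>\<in>space Q. add_point \<nu> x \<in> E} = ennreal (c j)" if j: "j \<in> J" and x: "x \<in> D j" for j x
  proof -
    have jm: "j < m" using j J by auto
    have ind: "indicator (D i) x = (if i = j then 1 else 0 :: ennreal)" if "i < m" for i
      using D(1) jm that x by (auto simp: disjoint_family_on_def indicator_def)
    have iff: "add_point \<nu> x \<in> E \<longleftrightarrow> (\<forall>i<m. emeasure \<nu> (D i) + (if i = j then 1 else 0) = of_nat (n i))"
      if "\<nu> \<in> counting_measures L" for \<nu>
      using that ind by (auto simp: E_def add_point_counting_measures emeasure_add_point_counting)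
    show ?thesis
    proof (cases "n j")
      case 0
      then have empty: "{\<nu>\<in>space Q. add_point \<nu> x \<in> E} = {}"
        using jm by (auto simp: space_Q iff intro!: exI[of _ j])
      show ?thesis
        unfolding empty by (simp add: c_def 0)
    next
      case (Suc k)
      have cancel: "e + 1 = of_nat (Suc k) \<longleftrightarrow> e = of_nat k" for e :: ennreal
        by (simp add: add.commute[of e] ennreal_add_left_cancel)
      have "add_point \<nu> x \<in> E \<longleftrightarrow> (\<forall>i<m. emeasure \<nu> (D i) = of_nat ((n(j := k)) i))"
        if "\<nu> \<in> counting_measures L" for \<nu>
        unfolding iff[OF that] using Suc cancel by (intro all_cong) simp
      then have "{\<nu>\<in>space Q. add_point \<nu> x \<in> E} =
          {\<nu>\<in>counting_measures L. \<forall>i<m. emeasure \<nu> (D i) = of_nat ((n(j := k)) i)}"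
        unfolding space_Q by (intro Collect_cong conj_cong refl)
      then show ?thesis
        by (simp add: emE c_def Suc del: fun_upd_apply)
    qed
  qed
  have disjJ: "disjoint_family_on D J"
    using D(1) J by (rule disjoint_family_on_mono[rotated])
  have "(\<integral>\<^sup>+\<nu>. emeasure \<nu> B * indicator E \<nu> \<partial>Q) = (\<integral>\<^sup>+\<nu>. ennreal (\<Sum>j\<in>J. real (n j)) * indicator E \<nu> \<partial>Q)"
  proof (intro nn_integral_cong)
    fix \<nu> assume \<nu>: "\<nu> \<in> space Q"
    show "emeasure \<nu> B * indicator E \<nu> = ennreal (\<Sum>j\<in>J. real (n j)) * indicator E \<nu>"
    proof (cases "\<nu> \<in> E")
      case True
      have "emeasure \<nu> B = (\<Sum>j\<in>J. emeasure \<nu> (D j))"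
        unfolding B using \<nu> fJ disjJ J Dsets by (intro emeasure_UN_atoms[of _ L]) (auto simp: space_Q)
      also have "\<dots> = (\<Sum>j\<in>J. of_nat (n j))"
        using True J by (intro sum.cong) (auto simp: E_def)
      finally show ?thesis
        by (simp add: ennreal_of_nat_eq_real_of_nat sum_ennreal)
    qed simp
  qed
  also have "\<dots> = ennreal (\<Sum>j\<in>J. real (n j)) * ennreal (p n)"
    using E emE[of n] by (simp add: E_def[symmetric] nn_integral_cmult_indicator)
  also have "\<dots> = ennreal (\<Sum>j\<in>J. measure L (D j) * c j)"
    using J term_eq by (simp add: ennreal_mult'[symmetric] p_nonneg sum_distrib_right sum_nonneg subset_iff cong: sum.cong)
  also have "\<dots> = (\<Sum>j\<in>J. ennreal (c j) * emeasure L (D j))"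
  proof -
    have "emeasure L (D j) = ennreal (measure L (D j))" "0 \<le> c j" if "j \<in> J" for j
      using D(2)[of j] J that by (auto simp: finite_sets_def emeasure_eq_ennreal_measure c_def p_nonneg)
    then show ?thesis
      by (subst sum_ennreal[symmetric]) (auto simp: ennreal_mult'[symmetric] mult.commute intro!: sum.cong)
  qed
  also have "\<dots> = (\<Sum>j\<in>J. \<integral>\<^sup>+x. ennreal (c j) * indicator (D j) x \<partial>L)"
    using J Dsets by (intro sum.cong) (auto simp: nn_integral_cmult_indicator)
  also have "\<dots> = (\<integral>\<^sup>+x. (\<Sum>j\<in>J. ennreal (c j) * indicator (D j) x) \<partial>L)"
    using J Dsets by (intro nn_integral_sum[symmetric]) auto
  also have "\<dots> = (\<integral>\<^sup>+x. emeasure Q {\<nu>\<in>space Q. add_point \<nu> x \<in> E} * indicator B x \<partial>L)"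
  proof (intro nn_integral_cong)
    fix x
    show "(\<Sum>j\<in>J. ennreal (c j) * indicator (D j) x) =
        emeasure Q {\<nu>\<in>space Q. add_point \<nu> x \<in> E} * indicator B x"
    proof (cases "x \<in> B")
      case True
      then obtain i where i: "i \<in> J" "x \<in> D i"
        unfolding B by auto
      have "(\<Sum>j\<in>J. ennreal (c j) * indicator (D j) x) = (\<Sum>j\<in>J. if j = i then ennreal (c i) else 0)"
        using i disjJ by (intro sum.cong) (auto simp: disjoint_family_on_def indicator_def)
      then show ?thesis
        using True i shifted[OF i] fJ by simp
    qed (auto simp: B)
  qed
  finally show ?thesis .
qed

section \<open>Mecke formula for events\<close>

context
  fixes B assumes B: "B \<in> finite_sets L"
begin

lemma finite_measure_density: "finite_measure (density L (indicator B))"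
  using B by (intro finite_measureI) (auto simp: emeasure_density finite_sets_def)

text \<open>Keeping the location of the added point as a second coordinate lets one computation
  serve twice: with full second factor for events of configurations, and with general rectangles for
  the joint formula.\<close>

lemma emeasure_distr_add_point:
  assumes E: "E \<in> sets (Q \<Otimes>\<^sub>M L)"
  shows "emeasure (distr (Q \<Otimes>\<^sub>M density L (indicator B)) (Q \<Otimes>\<^sub>M L)
      (\<lambda>p. (add_point (fst p) (snd p), snd p))) E =
    (\<integral>\<^sup>+x. emeasure Q {\<nu>\<in>space Q. (add_point \<nu> x, x) \<in> E} * indicator B x \<partial>L)"
proof -
  let ?R = "density L (indicator B)" and ?T = "\<lambda>p. (add_point (fst p) (snd p), snd p)"
  interpret R: finite_measure ?R by (rule finite_measure_density)
  interpret QR: pair_sigma_finite Q ?R by unfold_locales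
  have sets_QR: "sets (Q \<Otimes>\<^sub>M ?R) = sets (Q \<Otimes>\<^sub>M L)"
    by (rule sets_pair_measure_cong) simp_all
  have "(\<lambda>p. add_point (fst p) (snd p)) \<in> Q \<Otimes>\<^sub>M L \<rightarrow>\<^sub>M Q"
    unfolding measurable_Q by (rule measurable_add_point[OF measurable_fst_Q measurable_snd])
  then have T: "?T \<in> Q \<Otimes>\<^sub>M L \<rightarrow>\<^sub>M Q \<Otimes>\<^sub>M L"
    by (intro measurable_Pair measurable_snd)
  define X where "X = ?T -` E \<inter> space (Q \<Otimes>\<^sub>M L)"
  have X: "X \<in> sets (Q \<Otimes>\<^sub>M L)"
    unfolding X_def by (rule measurable_sets[OF T E])
  have "emeasure (distr (Q \<Otimes>\<^sub>M ?R) (Q \<Otimes>\<^sub>M L) ?T) E = emeasure (Q \<Otimes>\<^sub>M ?R) X"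
    using T E unfolding X_def measurable_cong_sets[OF sets_QR refl, symmetric]
      sets_eq_imp_space_eq[OF sets_QR, symmetric] by (rule emeasure_distr)
  also have "\<dots> = (\<integral>\<^sup>+x. emeasure Q ((\<lambda>\<nu>. (\<nu>, x)) -` X) \<partial>?R)"
    using X by (intro QR.emeasure_pair_measure_alt2) (simp add: sets_QR)
  also have "\<dots> = (\<integral>\<^sup>+x. indicator B x * emeasure Q ((\<lambda>\<nu>. (\<nu>, x)) -` X) \<partial>L)"
    by (intro nn_integral_density QL.measurable_emeasure_Pair2[OF X] borel_measurable_indicator finite_setsD(1)[OF B])
  also have "\<dots> = (\<integral>\<^sup>+x. emeasure Q {\<nu>\<in>space Q. (add_point \<nu> x, x) \<in> E} * indicator B x \<partial>L)"
  proof (rule nn_integral_cong)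
    fix x assume "x \<in> space L"
    then have "(\<lambda>\<nu>. (\<nu>, x)) -` X = {\<nu>\<in>space Q. (add_point \<nu> x, x) \<in> E}"
      by (auto simp: X_def space_pair_measure)
    then show "indicator B x * emeasure Q ((\<lambda>\<nu>. (\<nu>, x)) -` X) =
        emeasure Q {\<nu>\<in>space Q. (add_point \<nu> x, x) \<in> E} * indicator B x"
      by (simp only: mult.commute)
  qed
  finally show ?thesis .
qed

text \<open>Both sides are measures in \<open>E\<close>: the law weighted by the count of
  \<open>B\<close>, and the image of a finite product measure under adding a point in
  \<open>B\<close>. They agree when the counts of atoms refining \<open>B\<close> are fixed, which
  is the situation of \<open>measure_eqI_counts\<close>.\<close>

lemma mecke_event:
  assumes E: "E \<in> sets Q"
  shows "(\<integral>\<^sup>+\<nu>. emeasure \<nu> B * indicator E \<nu> \<partial>Q) =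
    (\<integral>\<^sup>+x. emeasure Q {\<nu>\<in>space Q. add_point \<nu> x \<in> E} * indicator B x \<partial>L)"
proof -
  let ?R = "density L (indicator B)" and ?T = "\<lambda>p. (add_point (fst p) (snd p), snd p)"
  let ?S = "\<lambda>p. add_point (fst p) (snd p)"
  let ?M1 = "density Q (\<lambda>\<nu>. emeasure \<nu> B)" and ?M2 = "distr (Q \<Otimes>\<^sub>M ?R) Q ?S"
  interpret R: finite_measure ?R by (rule finite_measure_density)
  interpret QR: pair_sigma_finite Q ?R by unfold_locales
  interpret QR: finite_measure "Q \<Otimes>\<^sub>M ?R"
    by (rule finite_measure_pair_measure) unfold_locales
  have sets_QR: "sets (Q \<Otimes>\<^sub>M ?R) = sets (Q \<Otimes>\<^sub>M L)"
    by (rule sets_pair_measure_cong) simp_all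
  have S: "?S \<in> Q \<Otimes>\<^sub>M ?R \<rightarrow>\<^sub>M Q"
    using measurable_shift unfolding measurable_cong_sets[OF sets_QR refl] .
  then have T: "?T \<in> Q \<Otimes>\<^sub>M ?R \<rightarrow>\<^sub>M Q \<Otimes>\<^sub>M L"
    by (intro measurable_Pair) (auto intro: measurable_snd' measurable_cong_sets[THEN equalityD1, THEN subsetD])
  have M1: "emeasure ?M1 E = (\<integral>\<^sup>+\<nu>. emeasure \<nu> B * indicator E \<nu> \<partial>Q)" if "E \<in> sets Q" for E
    using measurable_count[OF finite_setsD(1)[OF B]] that by (rule emeasure_density)
  have M2: "emeasure ?M2 E = (\<integral>\<^sup>+x. emeasure Q {\<nu>\<in>space Q. add_point \<nu> x \<in> E} * indicator B x \<partial>L)"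
    if E: "E \<in> sets Q" for E
  proof -
    have EL: "E \<times> space L \<in> sets (Q \<Otimes>\<^sub>M L)"
      using E by simp
    have "emeasure ?M2 E = emeasure (distr (Q \<Otimes>\<^sub>M ?R) (Q \<Otimes>\<^sub>M L) ?T) (E \<times> space L)"
      unfolding emeasure_distr[OF S E] emeasure_distr[OF T EL]
      by (rule arg_cong[where f = "emeasure _"]) (auto simp: space_pair_measure)
    also have "\<dots> = (\<integral>\<^sup>+x. emeasure Q {\<nu>\<in>space Q. (add_point \<nu> x, x) \<in> E \<times> space L} * indicator B x \<partial>L)"
      by (rule emeasure_distr_add_point[OF EL])
    also have "\<dots> = (\<integral>\<^sup>+x. emeasure Q {\<nu>\<in>space Q. add_point \<nu> x \<in> E} * indicator B x \<partial>L)"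
      by (intro nn_integral_cong) simp
    finally show ?thesis .
  qed
  have "?M1 = ?M2"
  proof (rule measure_eqI_counts[OF sigma_finite B])
    show "finite_measure ?M2"
      by (rule QR.finite_measure_distr[OF S])
    fix C assume C: "C \<in> finite_sets L"
    then have Cs: "C \<in> sets L" by (simp add: finite_sets_def)
    show "AE \<nu> in ?M1. emeasure \<nu> C < \<infinity>"
      using AE_finite_counts[OF C] by (subst AE_density[OF measurable_count[OF finite_setsD(1)[OF B]]]) auto
    have fin_pred: "{\<nu>\<in>space Q. emeasure \<nu> C < \<infinity>} \<in> sets Q"
      using measurable_count[OF Cs] by measurable
    have "AE p in Q \<Otimes>\<^sub>M ?R. emeasure (?S p) C < \<infinity>"
    proof (rule QR.AE_pair_measure)
      show "{p\<in>space (Q \<Otimes>\<^sub>M ?R). emeasure (?S p) C < \<infinity>} \<in> sets (Q \<Otimes>\<^sub>M ?R)"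
        using measurable_compose[OF S measurable_count[OF Cs]] by measurable
      show "AE \<nu> in Q. AE x in ?R. emeasure (?S (\<nu>, x)) C < \<infinity>"
        using AE_finite_counts[OF C] AE_space
      proof eventually_elim
        case (elim \<nu>)
        then have "emeasure (?S (\<nu>, x)) C < \<infinity>" for x
          using Cs emeasure_add_point_counting[of \<nu> L C x]
          by (simp add: space_Q indicator_def less_top[symmetric])
        then show ?case by simp
      qed
    qed
    then show "AE \<nu> in ?M2. emeasure \<nu> C < \<infinity>"
      by (subst AE_distr_iff[OF S fin_pred])
  next
    fix m :: nat and D :: "nat \<Rightarrow> 'a set" and n J
    assume D: "disjoint_family_on D {..<m}" "\<And>j. j < m \<Longrightarrow> D j \<in> finite_sets L"
      "J \<subseteq> {..<m}" "B = (\<Union>j\<in>J. D j)"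
    have Es: "{\<nu>\<in>counting_measures L. \<forall>j<m. emeasure \<nu> (D j) = of_nat (n j)} \<in> sets Q"
      by (rule sets_counts[OF D(2)])
    show "emeasure ?M1 {\<nu>\<in>counting_measures L. \<forall>j<m. emeasure \<nu> (D j) = of_nat (n j)} =
        emeasure ?M2 {\<nu>\<in>counting_measures L. \<forall>j<m. emeasure \<nu> (D j) = of_nat (n j)}"
      unfolding M1[OF Es] M2[OF Es]
      by (rule mecke_counts[OF D])
  qed (simp_all add: sets_Q)
  then show ?thesis
    using M1[OF E] M2[OF E] by simp
qed

end

section \<open>Mecke formula for nonnegative integrands on a set of finite intensity\<close>

context
  fixes A assumes A: "A \<in> finite_sets L"
begin

abbreviation (input) "R \<equiv> density L (indicator A)"
abbreviation (input) "K \<equiv> trace_measure A"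

lemma sets_pair_density: "sets (Q \<Otimes>\<^sub>M R) = sets (Q \<Otimes>\<^sub>M L)"
  by (rule sets_pair_measure_cong) simp_all

lemma sets_trace: "\<nu> \<in> space Q \<Longrightarrow> sets (K \<nu>) = sets L"
  by (simp add: space_Q counting_measuresD)

lemma finite_trace: "\<nu> \<in> space Q \<Longrightarrow> finite_measure (K \<nu>)"
  using finite_setsD(1)[OF A] by (intro finite_trace_measure) (simp add: space_Q counting_measuresD)

lemma space_trace: "\<nu> \<in> space Q \<Longrightarrow> space (K \<nu>) = space L"
  by (rule sets_eq_imp_space_eq[OF sets_trace])

lemma measurable_shift_pair:
  "(\<lambda>p. (add_point (fst p) (snd p), snd p)) \<in> Q \<Otimes>\<^sub>M R \<rightarrow>\<^sub>M Q \<Otimes>\<^sub>M L"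
  unfolding measurable_cong_sets[OF sets_pair_density refl]
  by (intro measurable_Pair measurable_shift measurable_snd)

abbreviation (input) "shifted \<equiv>
  distr (Q \<Otimes>\<^sub>M R) (Q \<Otimes>\<^sub>M L) (\<lambda>p. (add_point (fst p) (snd p), snd p))"

lemma finite_shifted: "finite_measure shifted"
proof -
  interpret R: finite_measure R by (rule finite_measure_density[OF A])
  interpret QR: finite_measure "Q \<Otimes>\<^sub>M R"
    by (rule finite_measure_pair_measure) unfold_locales
  show ?thesis
    by (rule QR.finite_measure_distr[OF measurable_shift_pair])
qed

text \<open>On a rectangle the inner measure is the count of \<open>A \<inter> b\<close> on the
  event \<open>a\<close>, which leads back to \<open>mecke_event\<close>; configurations with
  infinitely many points in \<open>A\<close> form a null set.\<close>

lemma mecke_rectangle: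
  assumes a: "a \<in> sets Q" and b: "b \<in> sets L"
  shows "(\<lambda>\<nu>. emeasure (K \<nu>) (Pair \<nu> -` (a \<times> b))) \<in> borel_measurable Q"
    and "(\<integral>\<^sup>+\<nu>. emeasure (K \<nu>) (Pair \<nu> -` (a \<times> b)) \<partial>Q) = emeasure shifted (a \<times> b)"
proof -
  have As: "A \<in> sets L" by (rule finite_setsD(1)[OF A])
  have Ab: "A \<inter> b \<in> finite_sets L"
  proof -
    have "emeasure L (A \<inter> b) \<le> emeasure L A"
      using As by (intro emeasure_mono) auto
    also have "\<dots> < \<infinity>"
      using A by (simp add: finite_sets_def)
    finally show ?thesis
      using As b by (simp add: finite_sets_def)
  qed
  have eq: "emeasure (K \<nu>) (Pair \<nu> -` (a \<times> b)) =
      (if emeasure \<nu> A < \<infinity> then emeasure \<nu> (A \<inter> b) * indicator a \<nu> else 0)"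
    if "\<nu> \<in> space Q" for \<nu>
    using that As b by (auto simp: emeasure_trace_measure space_Q counting_measuresD)
  have mA: "(\<lambda>\<nu>. emeasure \<nu> A) \<in> borel_measurable Q" and mAb: "(\<lambda>\<nu>. emeasure \<nu> (A \<inter> b)) \<in> borel_measurable Q"
    using As b by (auto intro!: measurable_count)
  have "(\<lambda>\<nu>. if emeasure \<nu> A < \<infinity> then emeasure \<nu> (A \<inter> b) * indicator a \<nu> else 0) \<in> borel_measurable Q"
    using mA mAb a by measurable
  then show "(\<lambda>\<nu>. emeasure (K \<nu>) (Pair \<nu> -` (a \<times> b))) \<in> borel_measurable Q"
    by (rule measurable_cong[THEN iffD2, rotated]) (rule eq)
  have "(\<integral>\<^sup>+\<nu>. emeasure (K \<nu>) (Pair \<nu> -` (a \<times> b)) \<partial>Q) = (\<integral>\<^sup>+\<nu>. emeasure \<nu> (A \<inter> b) * indicator a \<nu> \<partial>Q)"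
    using AE_finite_counts[OF A] AE_space
    by (intro nn_integral_cong_AE, eventually_elim) (simp only: eq if_True)
  also have "\<dots> = (\<integral>\<^sup>+x. emeasure Q {\<nu>\<in>space Q. add_point \<nu> x \<in> a} * indicator (A \<inter> b) x \<partial>L)"
    by (rule mecke_event[OF Ab a])
  also have "\<dots> = (\<integral>\<^sup>+x. emeasure Q {\<nu>\<in>space Q. (add_point \<nu> x, x) \<in> a \<times> b} * indicator A x \<partial>L)"
    by (intro nn_integral_cong) (simp add: indicator_def)
  also have "\<dots> = emeasure shifted (a \<times> b)"
    using a b by (intro emeasure_distr_add_point[OF A, symmetric]) simp
  finally show "(\<integral>\<^sup>+\<nu>. emeasure (K \<nu>) (Pair \<nu> -` (a \<times> b)) \<partial>Q) = emeasure shifted (a \<times> b)" .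
qed

text \<open>A Dynkin system argument from rectangles. Measurability and the identity are carried
  together because integrating differences and sums in the induction steps relies on the
  measurability already obtained.\<close>

lemma mecke_sets:
  assumes "E \<in> sets (Q \<Otimes>\<^sub>M L)"
  shows "(\<lambda>\<nu>. emeasure (K \<nu>) (Pair \<nu> -` E)) \<in> borel_measurable Q \<and>
    (\<integral>\<^sup>+\<nu>. emeasure (K \<nu>) (Pair \<nu> -` E) \<partial>Q) = emeasure shifted E"
  using Int_stable_pair_measure_generator[of Q L] pair_measure_closed[of Q L] assms[unfolded sets_pair_measure]
proof (induction rule: sigma_sets_induct_disjoint)
  case (basic E)
  then show ?case
    using mecke_rectangle by blast
next
  case empty
  show ?case by simp
next
  case (compl E)
  interpret S: finite_measure shifted by (rule finite_shifted)
  let ?\<Omega> = "space Q \<times> space L"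
  have E: "E \<in> sets (Q \<Otimes>\<^sub>M L)"
    using compl(1) by (simp add: sets_pair_measure)
  note rect = mecke_rectangle[OF sets.top sets.top]
  have IH: "(\<lambda>\<nu>. emeasure (K \<nu>) (Pair \<nu> -` E)) \<in> borel_measurable Q"
    "(\<integral>\<^sup>+\<nu>. emeasure (K \<nu>) (Pair \<nu> -` E) \<partial>Q) = emeasure shifted E"
    using compl.IH by blast+
  have sub: "Pair \<nu> -` E \<in> sets (K \<nu>)" if "\<nu> \<in> space Q" for \<nu>
    unfolding sets_trace[OF that] by (rule sets_Pair1[OF E])
  \<comment> \<open>The difference is legitimate because \<open>K \<nu>\<close> is finite at every
    configuration, including those where \<open>trace_measure\<close> falls back on the null
    measure.\<close>
  have diff: "emeasure (K \<nu>) (Pair \<nu> -` (?\<Omega> - E)) =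
      emeasure (K \<nu>) (Pair \<nu> -` ?\<Omega>) - emeasure (K \<nu>) (Pair \<nu> -` E)"
    if \<nu>: "\<nu> \<in> space Q" for \<nu>
  proof -
    interpret Kv: finite_measure "K \<nu>" by (rule finite_trace[OF \<nu>])
    have "Pair \<nu> -` ?\<Omega> = space (K \<nu>)"
      using \<nu> by (auto simp: space_trace)
    moreover have "Pair \<nu> -` (?\<Omega> - E) = space (K \<nu>) - Pair \<nu> -` E"
      using \<nu> by (auto simp: space_trace)
    ultimately show ?thesis
      using emeasure_compl[OF sub[OF \<nu>]] Kv.emeasure_finite by simp
  qed
  have meas: "(\<lambda>\<nu>. emeasure (K \<nu>) (Pair \<nu> -` ?\<Omega>) - emeasure (K \<nu>) (Pair \<nu> -` E)) \<in> borel_measurable Q"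
    using rect(1) IH(1) by measurable
  have "(\<integral>\<^sup>+\<nu>. emeasure (K \<nu>) (Pair \<nu> -` (?\<Omega> - E)) \<partial>Q) =
      (\<integral>\<^sup>+\<nu>. emeasure (K \<nu>) (Pair \<nu> -` ?\<Omega>) - emeasure (K \<nu>) (Pair \<nu> -` E) \<partial>Q)"
    by (rule nn_integral_cong[OF diff])
  also have "\<dots> = (\<integral>\<^sup>+\<nu>. emeasure (K \<nu>) (Pair \<nu> -` ?\<Omega>) \<partial>Q) - (\<integral>\<^sup>+\<nu>. emeasure (K \<nu>) (Pair \<nu> -` E) \<partial>Q)"
  proof (rule nn_integral_diff)
    show "AE \<nu> in Q. emeasure (K \<nu>) (Pair \<nu> -` E) \<le> emeasure (K \<nu>) (Pair \<nu> -` ?\<Omega>)"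
      using AE_space
    proof eventually_elim
      case (elim \<nu>)
      have "Pair \<nu> -` ?\<Omega> = space (K \<nu>)"
        using elim by (auto simp: space_trace)
      then show ?case
        by (simp only: emeasure_space)
    qed
  qed (use rect(1) IH S.emeasure_finite in simp_all)
  also have "\<dots> = emeasure shifted ?\<Omega> - emeasure shifted E"
    using rect(2) IH(2) by simp
  also have "\<dots> = emeasure shifted (?\<Omega> - E)"
    using emeasure_compl[of E shifted] E S.emeasure_finite by (simp add: space_pair_measure)
  finally show ?case
    using meas by (simp add: measurable_cong[OF diff])
next
  case (union E)
  have E: "E i \<in> sets (Q \<Otimes>\<^sub>M L)" for i
    using union(2) by (auto simp: sets_pair_measure)
  have sum: "emeasure (K \<nu>) (Pair \<nu> -` (\<Union>i. E i)) = (\<Sum>i. emeasure (K \<nu>) (Pair \<nu> -` E i))"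
    if \<nu>: "\<nu> \<in> space Q" for \<nu>
  proof -
    have "range (\<lambda>i. Pair \<nu> -` E i) \<subseteq> sets (K \<nu>)"
      unfolding sets_trace[OF \<nu>] using sets_Pair1[OF E] by blast
    moreover have "disjoint_family (\<lambda>i. Pair \<nu> -` E i)"
      using union(1) by (auto simp: disjoint_family_on_def)
    ultimately show ?thesis
      unfolding vimage_UN by (rule suminf_emeasure[symmetric])
  qed
  have IH: "(\<lambda>\<nu>. emeasure (K \<nu>) (Pair \<nu> -` E i)) \<in> borel_measurable Q"
    "(\<integral>\<^sup>+\<nu>. emeasure (K \<nu>) (Pair \<nu> -` E i) \<partial>Q) = emeasure shifted (E i)" for i
    using union.IH[of i] by auto
  have "(\<integral>\<^sup>+\<nu>. emeasure (K \<nu>) (Pair \<nu> -` (\<Union>i. E i)) \<partial>Q) = (\<integral>\<^sup>+\<nu>. (\<Sum>i. emeasure (K \<nu>) (Pair \<nu> -` E i)) \<partial>Q)"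
    by (rule nn_integral_cong[OF sum])
  also have "\<dots> = (\<Sum>i. emeasure shifted (E i))"
    using IH by (simp add: nn_integral_suminf)
  also have "\<dots> = emeasure shifted (\<Union>i. E i)"
    using union(1) E by (intro suminf_emeasure) auto
  finally have "(\<integral>\<^sup>+\<nu>. emeasure (K \<nu>) (Pair \<nu> -` (\<Union>i. E i)) \<partial>Q) = emeasure shifted (\<Union>i. E i)" .
  moreover have "(\<lambda>\<nu>. \<Sum>i. emeasure (K \<nu>) (Pair \<nu> -` E i)) \<in> borel_measurable Q"
    using IH(1) by measurable
  ultimately show ?case
    by (simp only: measurable_cong[OF sum])
qed

lemma mecke_nn_integral:
  assumes "h \<in> borel_measurable (Q \<Otimes>\<^sub>M L)"
  shows "(\<lambda>\<nu>. \<integral>\<^sup>+x. h (\<nu>, x) \<partial>K \<nu>) \<in> borel_measurable Q \<and>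
    (\<integral>\<^sup>+\<nu>. (\<integral>\<^sup>+x. h (\<nu>, x) \<partial>K \<nu>) \<partial>Q) = (\<integral>\<^sup>+p. h p \<partial>shifted)"
  using assms
proof (induction rule: borel_measurable_induct)
  case (cong f g)
  have eq: "(\<integral>\<^sup>+x. f (\<nu>, x) \<partial>K \<nu>) = (\<integral>\<^sup>+x. g (\<nu>, x) \<partial>K \<nu>)" if "\<nu> \<in> space Q" for \<nu>
    using that by (intro nn_integral_cong cong(3)) (simp add: space_trace space_pair_measure)
  have "(\<integral>\<^sup>+p. f p \<partial>shifted) = (\<integral>\<^sup>+p. g p \<partial>shifted)"
    using cong(3) by (intro nn_integral_cong) simp
  then show ?case
    using cong.IH by (simp only: measurable_cong[OF eq] nn_integral_cong[OF eq])
next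
  case (set E)
  have eq: "(\<integral>\<^sup>+x. indicator E (\<nu>, x) \<partial>K \<nu>) = emeasure (K \<nu>) (Pair \<nu> -` E)" if \<nu>: "\<nu> \<in> space Q" for \<nu>
  proof -
    have "(\<integral>\<^sup>+x. indicator E (\<nu>, x) \<partial>K \<nu>) = (\<integral>\<^sup>+x. indicator (Pair \<nu> -` E) x \<partial>K \<nu>)"
      by (intro nn_integral_cong) (simp add: indicator_def)
    also have "\<dots> = emeasure (K \<nu>) (Pair \<nu> -` E)"
      by (rule nn_integral_indicator) (unfold sets_trace[OF \<nu>], rule sets_Pair1[OF set])
    finally show ?thesis .
  qed
  have "(\<integral>\<^sup>+p. indicator E p \<partial>shifted) = emeasure shifted E"
    using set by (intro nn_integral_indicator) simp
  then show ?case
    using mecke_sets[OF set] by (simp only: measurable_cong[OF eq] nn_integral_cong[OF eq])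
next
  case (mult u c)
  have eq: "(\<integral>\<^sup>+x. c * u (\<nu>, x) \<partial>K \<nu>) = c * (\<integral>\<^sup>+x. u (\<nu>, x) \<partial>K \<nu>)" if \<nu>: "\<nu> \<in> space Q" for \<nu>
    using measurable_Pair2[OF mult(2) \<nu>]
    by (intro nn_integral_cmult) (simp add: measurable_cong_sets[OF sets_trace[OF \<nu>] refl])
  have "(\<integral>\<^sup>+p. c * u p \<partial>shifted) = c * (\<integral>\<^sup>+p. u p \<partial>shifted)"
    using mult(2) by (intro nn_integral_cmult) simp
  moreover have "(\<lambda>\<nu>. \<integral>\<^sup>+x. u (\<nu>, x) \<partial>K \<nu>) \<in> borel_measurable Q"
    using mult.IH by blast
  then have "(\<lambda>\<nu>. c * (\<integral>\<^sup>+x. u (\<nu>, x) \<partial>K \<nu>)) \<in> borel_measurable Q"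
    by measurable
  ultimately show ?case
    using mult.IH by (simp add: measurable_cong[OF eq] nn_integral_cong[OF eq] nn_integral_cmult)
next
  case (add u v)
  have eq: "(\<integral>\<^sup>+x. v (\<nu>, x) + u (\<nu>, x) \<partial>K \<nu>) = (\<integral>\<^sup>+x. v (\<nu>, x) \<partial>K \<nu>) + (\<integral>\<^sup>+x. u (\<nu>, x) \<partial>K \<nu>)"
    if \<nu>: "\<nu> \<in> space Q" for \<nu>
    using measurable_Pair2[OF add(1) \<nu>] measurable_Pair2[OF add(3) \<nu>]
    by (intro nn_integral_add) (simp_all add: measurable_cong_sets[OF sets_trace[OF \<nu>] refl])
  have "(\<integral>\<^sup>+p. v p + u p \<partial>shifted) = (\<integral>\<^sup>+p. v p \<partial>shifted) + (\<integral>\<^sup>+p. u p \<partial>shifted)"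
    using add by (intro nn_integral_add) simp_all
  moreover have IH: "(\<lambda>\<nu>. \<integral>\<^sup>+x. u (\<nu>, x) \<partial>K \<nu>) \<in> borel_measurable Q"
    "(\<lambda>\<nu>. \<integral>\<^sup>+x. v (\<nu>, x) \<partial>K \<nu>) \<in> borel_measurable Q"
    using add.IH by blast+
  then have "(\<lambda>\<nu>. (\<integral>\<^sup>+x. v (\<nu>, x) \<partial>K \<nu>) + (\<integral>\<^sup>+x. u (\<nu>, x) \<partial>K \<nu>)) \<in> borel_measurable Q"
    by measurable
  ultimately show ?case
    using add.IH by (simp add: measurable_cong[OF eq] nn_integral_cong[OF eq] nn_integral_add)
next
  case (seq U)
  have inc: "incseq (\<lambda>i x. U i (\<nu>, x))" for \<nu>
    using seq(3) by (auto simp: incseq_def le_fun_def)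
  have eq: "(\<integral>\<^sup>+x. (SUP i. U i) (\<nu>, x) \<partial>K \<nu>) = (SUP i. \<integral>\<^sup>+x. U i (\<nu>, x) \<partial>K \<nu>)"
    if \<nu>: "\<nu> \<in> space Q" for \<nu>
    unfolding SUP_apply using measurable_Pair2[OF seq(1) \<nu>]
    by (intro nn_integral_monotone_convergence_SUP inc)
      (simp add: measurable_cong_sets[OF sets_trace[OF \<nu>] refl])
  have IH: "(\<lambda>\<nu>. \<integral>\<^sup>+x. U i (\<nu>, x) \<partial>K \<nu>) \<in> borel_measurable Q"
    "(\<integral>\<^sup>+\<nu>. (\<integral>\<^sup>+x. U i (\<nu>, x) \<partial>K \<nu>) \<partial>Q) = (\<integral>\<^sup>+p. U i p \<partial>shifted)" for i
    using seq.IH[of i] by auto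
  have "(\<integral>\<^sup>+\<nu>. (\<integral>\<^sup>+x. (SUP i. U i) (\<nu>, x) \<partial>K \<nu>) \<partial>Q) = (\<integral>\<^sup>+\<nu>. (SUP i. \<integral>\<^sup>+x. U i (\<nu>, x) \<partial>K \<nu>) \<partial>Q)"
    by (rule nn_integral_cong[OF eq])
  also have "\<dots> = (SUP i. \<integral>\<^sup>+\<nu>. (\<integral>\<^sup>+x. U i (\<nu>, x) \<partial>K \<nu>) \<partial>Q)"
    using inc IH(1) by (intro nn_integral_monotone_convergence_SUP)
      (auto simp: incseq_def le_fun_def intro!: nn_integral_mono)
  also have "\<dots> = (SUP i. \<integral>\<^sup>+p. U i p \<partial>shifted)"
    by (simp only: IH(2))
  also have "\<dots> = (\<integral>\<^sup>+p. (SUP i. U i) p \<partial>shifted)"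
    unfolding SUP_apply using seq by (intro nn_integral_monotone_convergence_SUP[symmetric]) simp_all
  finally have "(\<integral>\<^sup>+\<nu>. (\<integral>\<^sup>+x. (SUP i. U i) (\<nu>, x) \<partial>K \<nu>) \<partial>Q) = (\<integral>\<^sup>+p. (SUP i. U i) p \<partial>shifted)" .
  moreover have "(\<lambda>\<nu>. SUP i. \<integral>\<^sup>+x. U i (\<nu>, x) \<partial>K \<nu>) \<in> borel_measurable Q"
    using IH(1) by (intro borel_measurable_SUP) auto
  ultimately show ?case
    by (simp only: measurable_cong[OF eq])
qed

text \<open>Only the integrating measures \<open>R\<close> and \<open>K\<close> are confined to
  \<open>A\<close>. Points are added to the whole configuration, so functionals of the whole
  configuration are covered.\<close>

lemma mecke_space_trace: "mecke_space Q R K add_point"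
proof -
  interpret R: finite_measure R by (rule finite_measure_density[OF A])
  interpret QR: pair_sigma_finite Q R by unfold_locales
  have As: "A \<in> sets L" by (rule finite_setsD(1)[OF A])
  have meas: "borel_measurable (Q \<Otimes>\<^sub>M R) = borel_measurable (Q \<Otimes>\<^sub>M L)"
    by (rule measurable_cong_sets[OF sets_pair_density refl])
  show ?thesis
  proof (intro mecke_space.intro mecke_space_axioms.intro)
    show "prob_space Q" "finite_measure R" by unfold_locales
    show "(\<lambda>p. add_point (fst p) (snd p)) \<in> Q \<Otimes>\<^sub>M R \<rightarrow>\<^sub>M Q"
      unfolding measurable_cong_sets[OF sets_pair_density refl] by (rule measurable_shift)
    show "add_point (add_point \<nu> x) y = add_point (add_point \<nu> y) x" for \<nu> :: "'a measure" and x y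
      by (rule add_point_commute)
    show "sets (K \<nu>) = sets R" if "\<nu> \<in> space Q" for \<nu>
      using sets_trace[OF that] by simp
    show "finite_measure (K \<nu>)" if "\<nu> \<in> space Q" for \<nu>
      by (rule finite_trace[OF that])
    show "(\<lambda>\<nu>. \<integral>\<^sup>+x. h (\<nu>, x) \<partial>K \<nu>) \<in> borel_measurable Q" if "h \<in> borel_measurable (Q \<Otimes>\<^sub>M R)" for h
      using mecke_nn_integral[of h] that unfolding meas by blast
    show "(\<integral>\<^sup>+\<nu>. (\<integral>\<^sup>+x. h (\<nu>, x) \<partial>K \<nu>) \<partial>Q) =
        (\<integral>\<^sup>+p. h (add_point (fst p) (snd p), snd p) \<partial>(Q \<Otimes>\<^sub>M R))" if "h \<in> borel_measurable (Q \<Otimes>\<^sub>M R)" for h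
      using mecke_nn_integral[of h] that nn_integral_distr[OF measurable_shift_pair, of h]
      unfolding meas by simp
    have mA: "(\<lambda>p. emeasure (fst p) A) \<in> borel_measurable (Q \<Otimes>\<^sub>M R)"
      by (rule measurable_compose[OF measurable_fst measurable_count[OF As]])
    \<comment> \<open>Off this event either \<open>K\<close> does not see the added point or it is
      the null measure; this is why the last axiom holds only almost everywhere.\<close>
    have "AE p in Q \<Otimes>\<^sub>M R. emeasure (fst p) A < \<infinity> \<and> snd p \<in> A"
    proof (rule QR.AE_pair_measure)
      have "snd -` A \<inter> space (Q \<Otimes>\<^sub>M R) \<in> sets (Q \<Otimes>\<^sub>M R)"
        using As by (intro measurable_sets[OF measurable_snd]) simp
      moreover have "{p\<in>space (Q \<Otimes>\<^sub>M R). emeasure (fst p) A < \<infinity>} \<in> sets (Q \<Otimes>\<^sub>M R)"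
        using mA by measurable
      moreover have "{p\<in>space (Q \<Otimes>\<^sub>M R). emeasure (fst p) A < \<infinity> \<and> snd p \<in> A} =
          {p\<in>space (Q \<Otimes>\<^sub>M R). emeasure (fst p) A < \<infinity>} \<inter> (snd -` A \<inter> space (Q \<Otimes>\<^sub>M R))"
        by auto
      ultimately show "{p\<in>space (Q \<Otimes>\<^sub>M R). emeasure (fst p) A < \<infinity> \<and> snd p \<in> A} \<in> sets (Q \<Otimes>\<^sub>M R)"
        by auto
      have "AE x in R. x \<in> A"
        using As by (subst AE_density) (auto simp: indicator_def)
      then show "AE \<nu> in Q. AE x in R. emeasure (fst (\<nu>, x)) A < \<infinity> \<and> snd (\<nu>, x) \<in> A"
        using AE_finite_counts[OF A] by (auto elim!: eventually_mono)
    qed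
    then show "AE p in Q \<Otimes>\<^sub>M R. \<forall>f\<in>borel_measurable R.
        (\<integral>\<^sup>+y. f y \<partial>K (add_point (fst p) (snd p))) = f (snd p) + (\<integral>\<^sup>+y. f y \<partial>K (fst p))"
      using AE_space
    proof eventually_elim
      case (elim p)
      obtain \<nu> x where p: "p = (\<nu>, x)" by (cases p)
      have \<nu>: "\<nu> \<in> counting_measures L" and x: "x \<in> A" and fin: "emeasure \<nu> A < \<infinity>"
        using elim by (auto simp: p space_pair_measure space_Q)
      have s: "sets \<nu> = sets L"
        by (rule counting_measuresD[OF \<nu>])
      have fin': "emeasure (add_point \<nu> x) A < \<infinity>"
        using fin x emeasure_add_point_counting[OF \<nu> As, of x] by (simp add: less_top[symmetric])
      show ?case
      proof
        fix f :: "'a \<Rightarrow> ennreal" assume "f \<in> borel_measurable R"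
        then have f: "f \<in> borel_measurable L"
          by simp
        have f\<nu>: "f \<in> borel_measurable \<nu>" "f \<in> borel_measurable (add_point \<nu> x)"
          using f by (simp_all add: measurable_cong_sets[OF s refl] measurable_cong_sets[OF sets_add_point refl])
        have i\<nu>: "(indicator A :: _ \<Rightarrow> ennreal) \<in> borel_measurable \<nu>"
          "(indicator A :: _ \<Rightarrow> ennreal) \<in> borel_measurable (add_point \<nu> x)"
          unfolding measurable_cong_sets[OF s refl] measurable_cong_sets[OF sets_add_point refl]
          by (rule borel_measurable_indicator[OF As])+
        have "(\<integral>\<^sup>+y. f y \<partial>K (add_point \<nu> x)) = (\<integral>\<^sup>+y. indicator A y * f y \<partial>add_point \<nu> x)"
          unfolding trace_measure_def using fin' nn_integral_density[OF i\<nu>(2) f\<nu>(2)] by (simp only: if_True)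
        also have "\<dots> = indicator A x * f x + (\<integral>\<^sup>+y. indicator A y * f y \<partial>\<nu>)"
        proof (rule nn_integral_add_point)
          show "x \<in> space \<nu>"
            using x sets.sets_into_space[OF As] counting_measuresD(2)[OF \<nu>] by blast
          show "(\<lambda>y. indicator A y * f y) \<in> borel_measurable \<nu>"
            by (rule borel_measurable_times_ennreal[OF i\<nu>(1) f\<nu>(1)])
        qed
        also have "(\<integral>\<^sup>+y. indicator A y * f y \<partial>\<nu>) = (\<integral>\<^sup>+y. f y \<partial>K \<nu>)"
          unfolding trace_measure_def using fin nn_integral_density[OF i\<nu>(1) f\<nu>(1)] by (simp only: if_True)
        also have "indicator A x * f x = f x"
          using x by simp
        finally show "(\<integral>\<^sup>+y. f y \<partial>K (add_point (fst p) (snd p))) = f (snd p) + (\<integral>\<^sup>+y. f y \<partial>K (fst p))"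
          by (simp add: p)
      qed
    qed
  qed
qed

end

subsection \<open>The variance inequality\<close>

lemma measurable_diff_op:
  assumes F: "F \<in> borel_measurable (counting_algebra L)"
  shows "(\<lambda>p. diff_op (snd p) F (fst p)) \<in> borel_measurable (counting_algebra L \<Otimes>\<^sub>M L)"
    and "(\<lambda>p. diff_op2 (fst (snd p)) (snd (snd p)) F (fst p)) \<in> borel_measurable (counting_algebra L \<Otimes>\<^sub>M (L \<Otimes>\<^sub>M L))"
proof -
  let ?N = "counting_algebra L"
  have 1: "(\<lambda>p. F (add_point (f p) (g p))) \<in> borel_measurable M" "(\<lambda>p. F (f p)) \<in> borel_measurable M"
    if "f \<in> M \<rightarrow>\<^sub>M ?N" "g \<in> M \<rightarrow>\<^sub>M L" for f g and M :: "'c measure"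
    using that by (auto intro!: measurable_compose[OF _ F] measurable_add_point)
  show "(\<lambda>p. diff_op (snd p) F (fst p)) \<in> borel_measurable (?N \<Otimes>\<^sub>M L)"
    unfolding diff_op_def
    by (intro borel_measurable_diff 1[OF measurable_fst measurable_snd])
  have b: "(\<lambda>p. snd (snd p)) \<in> ?N \<Otimes>\<^sub>M (L \<Otimes>\<^sub>M L) \<rightarrow>\<^sub>M L" "(\<lambda>p. fst (snd p)) \<in> ?N \<Otimes>\<^sub>M (L \<Otimes>\<^sub>M L) \<rightarrow>\<^sub>M L"
    by (rule measurable_compose[OF measurable_snd measurable_snd]
      measurable_compose[OF measurable_snd measurable_fst])+
  note a = measurable_add_point[OF measurable_fst b(2)]
  show "(\<lambda>p. diff_op2 (fst (snd p)) (snd (snd p)) F (fst p)) \<in> borel_measurable (?N \<Otimes>\<^sub>M (L \<Otimes>\<^sub>M L))"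
    unfolding diff_op2_eq
    by (intro borel_measurable_add borel_measurable_diff 1(1)[OF a b(1)] 1(1)[OF measurable_fst b(1)]
      1(1)[OF measurable_fst b(2)] 1(2)[OF measurable_fst b(1)])
qed

text \<open>The right-hand side depends neither on \<open>k\<close> nor on \<open>A\<close>, which
  leaves only the left-hand side to a limit.\<close>

lemma truncated_variance_bound:
  assumes F: "F \<in> borel_measurable (counting_algebra L)" and F2: "integrable Q (\<lambda>\<nu>. (F \<nu>)\<^sup>2)"
    and t: "0 \<le> t" "t \<le> 2" and A: "A \<in> finite_sets L" and k: "0 \<le> k"
  shows "ennreal (2 * t - t\<^sup>2) *
      (\<integral>\<^sup>+\<nu>. (\<integral>\<^sup>+x. ennreal ((clamp_real k (diff_op x F \<nu>))\<^sup>2) * indicator A x \<partial>L) \<partial>Q) \<le>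
    ennreal (variance F) + ennreal (t\<^sup>2) *
      (\<integral>\<^sup>+\<nu>. (\<integral>\<^sup>+(x, y). ennreal ((diff_op2 x y F \<nu>)\<^sup>2) \<partial>(L \<Otimes>\<^sub>M L)) \<partial>Q)"
proof -
  let ?R = "density L (indicator A)"
  interpret M: mecke_space Q ?R "trace_measure A" add_point
    by (rule mecke_space_trace[OF A])
  have As: "A \<in> sets L" by (rule finite_setsD(1)[OF A])
  have sets_R: "sets ?R = sets L" by simp
  have sets_NR: "sets (Q \<Otimes>\<^sub>M ?R) = sets (counting_algebra L \<Otimes>\<^sub>M L)"
    by (rule sets_pair_measure_cong[OF sets_Q sets_R])
  obtain g where g: "g \<in> borel_measurable (counting_algebra L \<Otimes>\<^sub>M L)"
    "\<And>\<nu> x. \<nu> \<in> counting_measures L \<Longrightarrow> x \<in> space L \<Longrightarrow> g (add_point \<nu> x, x) = F \<nu>"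
    using add_point_factorization[OF F] by metis
  \<comment> \<open>\<open>g\<close> recovers the value of \<open>F\<close> before the point was
    added, so at an enlarged configuration \<open>w\<close> is the truncation of D_xF.\<close>
  define w where "w p = clamp_real k (F (fst p) - g p)" for p
  have FQ: "F \<in> borel_measurable Q"
    using F by (simp only: measurable_Q)
  have w: "w \<in> borel_measurable (Q \<Otimes>\<^sub>M ?R)"
    unfolding w_def measurable_cong_sets[OF sets_NR refl]
    using measurable_compose[OF measurable_fst F] g(1) by measurable
  have wk: "\<bar>w p\<bar> \<le> k" for p
    unfolding w_def by (rule abs_clamp_real_le[OF k])
  have w_eq: "w (add_point \<nu> x, x) = clamp_real k (diff_op x F \<nu>)"
    if "\<nu> \<in> space Q" "x \<in> space L" for \<nu> x
    using that g(2)[of \<nu> x] by (simp add: w_def diff_op_def space_Q)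
  have pos: "AE p in Q \<Otimes>\<^sub>M ?R. (w (add_point (fst p) (snd p), snd p))\<^sup>2 \<le>
      (F (add_point (fst p) (snd p)) - F (fst p)) * w (add_point (fst p) (snd p), snd p)"
    using AE_space
  proof eventually_elim
    case (elim p)
    then have "w (add_point (fst p) (snd p), snd p) = clamp_real k (diff_op (snd p) F (fst p))"
      by (intro w_eq) (auto simp: space_pair_measure)
    then show ?case
      using clamp_real_square_le[OF k] by (simp add: diff_op_def)
  qed
  define X where "X = (\<integral>\<^sup>+p. ennreal ((w (add_point (fst p) (snd p), snd p))\<^sup>2) \<partial>(Q \<Otimes>\<^sub>M ?R))"
  define Y where "Y = (\<integral>\<^sup>+((\<nu>, y), x). ennreal ((w (add_point (add_point \<nu> y) x, x) - w (add_point \<nu> x, x))\<^sup>2)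
    \<partial>((Q \<Otimes>\<^sub>M ?R) \<Otimes>\<^sub>M ?R))"
  let ?S2 = "\<integral>\<^sup>+\<nu>. (\<integral>\<^sup>+(x, y). ennreal ((diff_op2 x y F \<nu>)\<^sup>2) \<partial>(L \<Otimes>\<^sub>M L)) \<partial>Q"
  have bound: "ennreal (2 * t) * X \<le> ennreal (variance F) + ennreal (t\<^sup>2) * (X + Y)"
    unfolding X_def Y_def by (rule M.variance_lower_bound[OF w wk FQ F2 pos t(1)])

  \<comment> \<open>Boundedness of \<open>w\<close> and finiteness of the product measure make
    \<open>X\<close> finite; this is what later permits cancelling \<open>t\<^sup>2\<close> times
    \<open>X\<close>.\<close>
  have "X \<le> (\<integral>\<^sup>+p. ennreal (k\<^sup>2) \<partial>(Q \<Otimes>\<^sub>M ?R))"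
    unfolding X_def using power_mono[OF wk abs_ge_zero, of _ 2]
    by (intro nn_integral_mono ennreal_leI) simp
  also have "\<dots> < \<infinity>"
    using M.QR.emeasure_finite[of "space (Q \<Otimes>\<^sub>M ?R)"]
    by (simp add: ennreal_mult_eq_top_iff less_top[symmetric])
  finally have X_fin: "X < \<infinity>" .

  have mX: "(\<lambda>p. ennreal ((w (add_point (fst p) (snd p), snd p))\<^sup>2)) \<in> borel_measurable (Q \<Otimes>\<^sub>M ?R)"
    using w M.add_measurable by measurable
  have X_eq: "X = (\<integral>\<^sup>+\<nu>. (\<integral>\<^sup>+x. ennreal ((clamp_real k (diff_op x F \<nu>))\<^sup>2) * indicator A x \<partial>L) \<partial>Q)"
    unfolding X_def M.R.nn_integral_fst[OF mX, symmetric]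
  proof (rule nn_integral_cong)
    fix \<nu> assume \<nu>: "\<nu> \<in> space Q"
    have "(\<lambda>x. ennreal ((w (add_point \<nu> x, x))\<^sup>2)) \<in> borel_measurable ?R"
      using measurable_Pair2[OF mX \<nu>] by simp
    then have "(\<integral>\<^sup>+x. ennreal ((w (add_point \<nu> x, x))\<^sup>2) \<partial>?R) =
        (\<integral>\<^sup>+x. indicator A x * ennreal ((w (add_point \<nu> x, x))\<^sup>2) \<partial>L)"
      using As by (intro nn_integral_density) simp_all
    also have "\<dots> = (\<integral>\<^sup>+x. ennreal ((clamp_real k (diff_op x F \<nu>))\<^sup>2) * indicator A x \<partial>L)"
      by (intro nn_integral_cong) (simp add: w_eq[OF \<nu>] mult.commute)
    finally show "(\<integral>\<^sup>+x. ennreal ((w (add_point (fst (\<nu>, x)) (snd (\<nu>, x)), snd (\<nu>, x)))\<^sup>2) \<partial>?R) = \<dots>"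
      by simp
  qed

  define h where "h q = ennreal ((diff_op2 (snd (fst q)) (snd q) F (fst (fst q)))\<^sup>2)" for q
  have h: "h \<in> borel_measurable ((Q \<Otimes>\<^sub>M L) \<Otimes>\<^sub>M L)"
  proof -
    have "(\<lambda>q. (fst (fst q), (snd (fst q), snd q))) \<in> (Q \<Otimes>\<^sub>M L) \<Otimes>\<^sub>M L \<rightarrow>\<^sub>M counting_algebra L \<Otimes>\<^sub>M (L \<Otimes>\<^sub>M L)"
      by (intro measurable_Pair measurable_compose[OF measurable_fst] measurable_fst_Q measurable_snd)
    from measurable_compose[OF this measurable_diff_op(2)[OF F]]
    show ?thesis
      unfolding h_def by simp
  qed
  have "sets ((Q \<Otimes>\<^sub>M ?R) \<Otimes>\<^sub>M ?R) = sets ((Q \<Otimes>\<^sub>M L) \<Otimes>\<^sub>M L)"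
    by (intro sets_pair_measure_cong refl sets_R)
  then have hR: "h \<in> borel_measurable ((Q \<Otimes>\<^sub>M ?R) \<Otimes>\<^sub>M ?R)"
    using h measurable_cong_sets by blast
  have "Y \<le> (\<integral>\<^sup>+q. h q \<partial>((Q \<Otimes>\<^sub>M ?R) \<Otimes>\<^sub>M ?R))"
    unfolding Y_def
  proof (rule nn_integral_mono)
    fix q assume "q \<in> space ((Q \<Otimes>\<^sub>M ?R) \<Otimes>\<^sub>M ?R)"
    then obtain \<nu> y x where q: "q = ((\<nu>, y), x)" and sp: "\<nu> \<in> space Q" "y \<in> space L" "x \<in> space L"
      by (auto simp: space_pair_measure)
    have "add_point \<nu> y \<in> space Q"
      using sp by (simp add: space_Q add_point_counting_measures)
    then have "w (add_point (add_point \<nu> y) x, x) - w (add_point \<nu> x, x) =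
        clamp_real k (diff_op x F (add_point \<nu> y)) - clamp_real k (diff_op x F \<nu>)"
      using sp by (simp add: w_eq)
    also have "\<bar>\<dots>\<bar> \<le> \<bar>diff_op2 y x F \<nu>\<bar>"
      using abs_clamp_real_diff_le by (simp add: diff_op2_def diff_op_def[of y])
    finally show "(\<lambda>((\<nu>, y), x).
        ennreal ((w (add_point (add_point \<nu> y) x, x) - w (add_point \<nu> x, x))\<^sup>2)) q \<le> h q"
      by (simp add: q h_def abs_le_square_iff)
  qed
  also have "\<dots> = (\<integral>\<^sup>+\<nu>. (\<integral>\<^sup>+y. (\<integral>\<^sup>+x. h ((\<nu>, y), x) \<partial>?R) \<partial>?R) \<partial>Q)"
    using hR by (simp add: M.R.nn_integral_fst[symmetric] M.R.borel_measurable_nn_integral_fst)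
  also have "\<dots> \<le> (\<integral>\<^sup>+\<nu>. (\<integral>\<^sup>+y. (\<integral>\<^sup>+x. h ((\<nu>, y), x) \<partial>L) \<partial>L) \<partial>Q)"
  proof (rule nn_integral_mono)
    fix \<nu> assume \<nu>: "\<nu> \<in> space Q"
    have "(\<integral>\<^sup>+y. (\<integral>\<^sup>+x. h ((\<nu>, y), x) \<partial>?R) \<partial>?R) \<le> (\<integral>\<^sup>+y. (\<integral>\<^sup>+x. h ((\<nu>, y), x) \<partial>L) \<partial>?R)"
    proof (rule nn_integral_mono)
      fix y assume "y \<in> space ?R"
      then have "(\<nu>, y) \<in> space (Q \<Otimes>\<^sub>M L)"
        using \<nu> by (simp add: space_pair_measure)
      from measurable_Pair2[OF h this]
      show "(\<integral>\<^sup>+x. h ((\<nu>, y), x) \<partial>?R) \<le> (\<integral>\<^sup>+x. h ((\<nu>, y), x) \<partial>L)"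
        by (rule nn_integral_density_indicator_le[OF As])
    qed
    also have "\<dots> \<le> (\<integral>\<^sup>+y. (\<integral>\<^sup>+x. h ((\<nu>, y), x) \<partial>L) \<partial>L)"
      using measurable_Pair2[OF L.borel_measurable_nn_integral_fst[OF h] \<nu>]
      by (rule nn_integral_density_indicator_le[OF As])
    finally show "(\<integral>\<^sup>+y. (\<integral>\<^sup>+x. h ((\<nu>, y), x) \<partial>?R) \<partial>?R) \<le> (\<integral>\<^sup>+y. (\<integral>\<^sup>+x. h ((\<nu>, y), x) \<partial>L) \<partial>L)" .
  qed
  also have "\<dots> = ?S2"
  proof (rule nn_integral_cong)
    fix \<nu> assume \<nu>: "\<nu> \<in> space Q"
    have "(\<lambda>z. ennreal ((diff_op2 (fst z) (snd z) F \<nu>)\<^sup>2)) \<in> borel_measurable (L \<Otimes>\<^sub>M L)"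
      using measurable_Pair2[OF measurable_diff_op(2)[OF F], of \<nu>] \<nu>
      by (simp add: space_Q space_counting_algebra)
    from L.nn_integral_fst[OF this]
    show "(\<integral>\<^sup>+y. (\<integral>\<^sup>+x. h ((\<nu>, y), x) \<partial>L) \<partial>L) = (\<integral>\<^sup>+(x, y). ennreal ((diff_op2 x y F \<nu>)\<^sup>2) \<partial>(L \<Otimes>\<^sub>M L))"
      by (simp add: h_def split_beta')
  qed
  finally have Y_le: "Y \<le> ?S2" .

  \<comment> \<open>\<open>ennreal\<close> would replace a negative coefficient by 0, so splitting
    2t into t^2 and 2t - t^2 relies on t <= 2.\<close>
  have t2: "0 \<le> 2 * t - t\<^sup>2"
    using t mult_right_mono[of t 2 t] by (simp add: power2_eq_square)
  have "ennreal (t\<^sup>2) * X + ennreal (2 * t - t\<^sup>2) * X = ennreal (2 * t) * X"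
    using t2 by (simp add: distrib_right[symmetric] ennreal_plus[symmetric] del: ennreal_plus)
  also have "\<dots> \<le> ennreal (variance F) + ennreal (t\<^sup>2) * (X + ?S2)"
    using bound Y_le by (meson add_left_mono mult_left_mono order_trans zero_le)
  also have "\<dots> = ennreal (t\<^sup>2) * X + (ennreal (variance F) + ennreal (t\<^sup>2) * ?S2)"
    by (simp add: distrib_left ac_simps)
  finally have "ennreal (2 * t - t\<^sup>2) * X \<le> ennreal (variance F) + ennreal (t\<^sup>2) * ?S2"
    using X_fin by (auto simp: ennreal_add_left_cancel_le ennreal_mult_eq_top_iff)
  then show ?thesis
    unfolding X_eq .
qed

text \<open>The truncation level and the exhausting set share the index n, so that a single monotone
  limit removes both.\<close>

lemma variance_bound:
  assumes F: "F \<in> borel_measurable (counting_algebra L)" and F2: "integrable Q (\<lambda>\<nu>. (F \<nu>)\<^sup>2)"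
    and t: "0 \<le> t" "t \<le> 2"
  shows "ennreal (2 * t - t\<^sup>2) * (\<integral>\<^sup>+\<nu>. (\<integral>\<^sup>+x. ennreal ((diff_op x F \<nu>)\<^sup>2) \<partial>L) \<partial>Q) \<le>
    ennreal (variance F) + ennreal (t\<^sup>2) *
      (\<integral>\<^sup>+\<nu>. (\<integral>\<^sup>+(x, y). ennreal ((diff_op2 x y F \<nu>)\<^sup>2) \<partial>(L \<Otimes>\<^sub>M L)) \<partial>Q)"
proof -
  obtain A :: "nat \<Rightarrow> 'a set" where A: "range A \<subseteq> sets L" "(\<Union>i. A i) = space L"
    "\<And>i. emeasure L (A i) \<noteq> \<infinity>" "incseq A"
    by (rule L.sigma_finite_incseq) blast
  have Af: "A n \<in> finite_sets L" for n
    using A(1,3) by (auto simp: finite_sets_def less_top)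
  define f where "f n \<nu> x = ennreal ((clamp_real (real n) (diff_op x F \<nu>))\<^sup>2) * indicator (A n) x" for n \<nu> x
  have inc: "f n \<nu> x \<le> f m \<nu> x" if "n \<le> m" for n m \<nu> x
    unfolding f_def using that incseqD[OF A(4) that]
    by (intro mult_mono ennreal_leI clamp_real_square_mono) (auto simp: indicator_def)
  have f_meas: "(\<lambda>p. f n (fst p) (snd p)) \<in> borel_measurable (Q \<Otimes>\<^sub>M L)" for n
  proof -
    have "(\<lambda>p. diff_op (snd p) F (fst p)) \<in> borel_measurable (Q \<Otimes>\<^sub>M L)"
      using measurable_diff_op(1)[OF F]
      by (simp only: measurable_cong_sets[OF sets_pair_measure_cong[OF sets_Q refl] refl])
    moreover have "A n \<in> sets L" using A(1) by auto
    ultimately show ?thesis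
      unfolding f_def by measurable
  qed
  have SUP_f: "(SUP n. f n \<nu> x) = ennreal ((diff_op x F \<nu>)\<^sup>2)" if x: "x \<in> space L" for \<nu> x
  proof (rule antisym)
    show "(SUP n. f n \<nu> x) \<le> ennreal ((diff_op x F \<nu>)\<^sup>2)"
    proof (rule SUP_least)
      fix n
      have "\<bar>clamp_real (real n) (diff_op x F \<nu>)\<bar> \<le> \<bar>diff_op x F \<nu>\<bar>"
        by (auto simp: clamp_real_def)
      then have "ennreal ((clamp_real (real n) (diff_op x F \<nu>))\<^sup>2) \<le> ennreal ((diff_op x F \<nu>)\<^sup>2)"
        by (intro ennreal_leI) (simp add: abs_le_square_iff)
      then show "f n \<nu> x \<le> ennreal ((diff_op x F \<nu>)\<^sup>2)"
        by (simp add: f_def indicator_def)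
    qed
    obtain i where i: "x \<in> A i"
      using x A(2) by blast
    obtain j where j: "\<bar>diff_op x F \<nu>\<bar> \<le> real j"
      using real_arch_simple by blast
    \<comment> \<open>From this index on the set contains x and the truncation is inactive.\<close>
    have "x \<in> A (max i j)"
      using i incseqD[OF A(4), of i "max i j"] by auto
    then have "f (max i j) \<nu> x = ennreal ((diff_op x F \<nu>)\<^sup>2)"
      using j by (simp add: f_def clamp_real_eq)
    then show "ennreal ((diff_op x F \<nu>)\<^sup>2) \<le> (SUP n. f n \<nu> x)"
      by (metis SUP_upper UNIV_I)
  qed
  have "(\<integral>\<^sup>+\<nu>. (\<integral>\<^sup>+x. ennreal ((diff_op x F \<nu>)\<^sup>2) \<partial>L) \<partial>Q) = (\<integral>\<^sup>+\<nu>. (\<integral>\<^sup>+x. (SUP n. f n \<nu> x) \<partial>L) \<partial>Q)"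
    by (intro nn_integral_cong) (simp add: SUP_f)
  also have "\<dots> = (\<integral>\<^sup>+\<nu>. (SUP n. \<integral>\<^sup>+x. f n \<nu> x \<partial>L) \<partial>Q)"
  proof (intro nn_integral_cong nn_integral_monotone_convergence_SUP)
    show "incseq (\<lambda>n. f n \<nu>)" for \<nu>
      using inc by (auto simp: incseq_def le_fun_def)
    show "f n \<nu> \<in> borel_measurable L" if "\<nu> \<in> space Q" for n \<nu>
      using measurable_Pair2[OF f_meas that] by simp
  qed
  also have "\<dots> = (SUP n. \<integral>\<^sup>+\<nu>. (\<integral>\<^sup>+x. f n \<nu> x \<partial>L) \<partial>Q)"
  proof (rule nn_integral_monotone_convergence_SUP)
    show "incseq (\<lambda>n \<nu>. \<integral>\<^sup>+x. f n \<nu> x \<partial>L)"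
      using inc by (auto simp: incseq_def le_fun_def intro!: nn_integral_mono)
    show "(\<lambda>\<nu>. \<integral>\<^sup>+x. f n \<nu> x \<partial>L) \<in> borel_measurable Q" for n
      using L.borel_measurable_nn_integral_fst[OF f_meas] by simp
  qed
  finally have "ennreal (2 * t - t\<^sup>2) * (\<integral>\<^sup>+\<nu>. (\<integral>\<^sup>+x. ennreal ((diff_op x F \<nu>)\<^sup>2) \<partial>L) \<partial>Q) =
      (SUP n. ennreal (2 * t - t\<^sup>2) * (\<integral>\<^sup>+\<nu>. (\<integral>\<^sup>+x. f n \<nu> x \<partial>L) \<partial>Q))"
    by (simp add: SUP_mult_left_ennreal)
  also have "\<dots> \<le> ennreal (variance F) + ennreal (t\<^sup>2) *
      (\<integral>\<^sup>+\<nu>. (\<integral>\<^sup>+(x, y). ennreal ((diff_op2 x y F \<nu>)\<^sup>2) \<partial>(L \<Otimes>\<^sub>M L)) \<partial>Q)"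
    unfolding f_def by (intro SUP_least truncated_variance_bound[OF F F2 t Af]) simp
  finally show ?thesis .
qed

end

section \<open>From the process to its law, and the choice of t\<close>

lemma poisson_law_distr:
  fixes L :: "'a measure"
  assumes L: "sigma_finite_measure L" and P: "poisson_process P L \<eta>"
  shows "poisson_law (distr P (counting_algebra L) \<eta>) L"
proof -
  interpret poisson_process P L \<eta> by fact
  show ?thesis
  proof (intro poisson_law.intro poisson_law_axioms.intro)
    show "prob_space (distr P (counting_algebra L) \<eta>)"
      by (rule prob_space_distr[OF random_element])
    show "sigma_finite_measure L" by fact
    show "sets (distr P (counting_algebra L) \<eta>) = sets (counting_algebra L)"
      by simp
    fix m :: nat and D :: "nat \<Rightarrow> 'a set" and n :: "nat \<Rightarrow> nat"
    assume D: "disjoint_family_on D {..<m}" "\<And>j. j < m \<Longrightarrow> D j \<in> finite_sets L"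
    have Ds: "D j \<in> sets L" "emeasure L (D j) < \<infinity>" if "j < m" for j
      using D(2)[OF that] by (auto simp: finite_sets_def)
    have \<eta>: "\<eta> \<omega> \<in> counting_measures L" if "\<omega> \<in> space P" for \<omega>
      using measurable_space[OF random_element that] by (simp add: space_counting_algebra)
    define E where "E = {\<nu>\<in>counting_measures L. \<forall>j<m. emeasure \<nu> (D j) = of_nat (n j)}"
    have E: "E \<in> sets (counting_algebra L)"
      unfolding E_def by (rule sets_counting_algebra_counts[OF Ds(1)])
    have "measure (distr P (counting_algebra L) \<eta>) E = prob (\<eta> -` E \<inter> space P)"
      by (rule measure_distr[OF random_element E])
    also have "\<dots> = (\<Prod>j<m. poisson_weight (measure L (D j)) (n j))"
    proof (cases "m = 0")
      \<comment> \<open>An intersection over no sets is \<open>UNIV\<close> rather than the sample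
        space, so \<open>m = 0\<close> is settled by itself.\<close>
      case True
      have "\<eta> -` E \<inter> space P = space P"
        using \<eta> by (auto simp: E_def True)
      then show ?thesis
        by (simp add: True prob_space)
    next
      case False
      let ?X = "\<lambda>j \<omega>. emeasure (\<eta> \<omega>) (D j)"
      have "\<eta> -` E \<inter> space P = (\<Inter>j\<in>{..<m}. ?X j -` {of_nat (n j)} \<inter> space P)"
        using \<eta> False by (auto simp: E_def)
      also have "prob \<dots> = (\<Prod>j\<in>{..<m}. prob (?X j -` {of_nat (n j)} \<inter> space P))"
        using False by (intro indep_varsD[OF independent[OF Ds(1) D(1)]]) auto
      also have "\<dots> = (\<Prod>j<m. poisson_weight (measure L (D j)) (n j))"
      proof (rule prod.cong[OF refl])
        fix j assume "j \<in> {..<m}"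
        then have j: "j < m" by simp
        have "?X j -` {of_nat (n j)} \<inter> space P = {\<omega>\<in>space P. ?X j \<omega> = of_nat (n j)}"
          by auto
        then show "prob (?X j -` {of_nat (n j)} \<inter> space P) = poisson_weight (measure L (D j)) (n j)"
          using poisson_finite[OF Ds[OF j], of "n j"] by (simp add: poisson_weight_def)
      qed
      finally show ?thesis .
    qed
    finally show "measure (distr P (counting_algebra L) \<eta>)
        {\<nu>\<in>counting_measures L. \<forall>j<m. emeasure \<nu> (D j) = of_nat (n j)} =
      (\<Prod>j<m. poisson_weight (measure L (D j)) (n j))"
      by (simp only: E_def)
  qed
qed

theorem theorem1p1:
  fixes P :: "'w measure" and L :: "'a measure" and \<eta> :: "'w \<Rightarrow> 'a measure"
    and F :: "'a measure \<Rightarrow> real" and \<alpha> :: real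
  assumes "sigma_finite_measure L"
    and "poisson_process P L \<eta>"
    and "F \<in> borel_measurable (counting_algebra L)"
    and "integrable P (\<lambda>\<omega>. (F (\<eta> \<omega>))\<^sup>2)"
    and "\<alpha> \<ge> 0"
    and "(\<integral>\<^sup>+\<omega>. (\<integral>\<^sup>+(x, y). ennreal ((diff_op2 x y F (\<eta> \<omega>))\<^sup>2) \<partial>(L \<Otimes>\<^sub>M L)) \<partial>P)
      \<le> ennreal \<alpha> * (\<integral>\<^sup>+\<omega>. (\<integral>\<^sup>+x. ennreal ((diff_op x F (\<eta> \<omega>))\<^sup>2) \<partial>L) \<partial>P)"
    and "ennreal \<alpha> * (\<integral>\<^sup>+\<omega>. (\<integral>\<^sup>+x. ennreal ((diff_op x F (\<eta> \<omega>))\<^sup>2) \<partial>L) \<partial>P) < \<infinity>"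
  shows "ennreal (prob_space.variance P (\<lambda>\<omega>. F (\<eta> \<omega>)))
      \<ge> ennreal (4 / (\<alpha> + 2)\<^sup>2) * (\<integral>\<^sup>+\<omega>. (\<integral>\<^sup>+x. ennreal ((diff_op x F (\<eta> \<omega>))\<^sup>2) \<partial>L) \<partial>P)"
proof -
  let ?N = "counting_algebra L"
  interpret P: poisson_process P L \<eta> by fact
  interpret poisson_law "distr P ?N \<eta>" L
    by (rule poisson_law_distr) fact+
  note \<eta> = P.random_element and F = assms(3)
  let ?S1 = "\<integral>\<^sup>+\<omega>. \<integral>\<^sup>+x. ennreal ((diff_op x F (\<eta> \<omega>))\<^sup>2) \<partial>L \<partial>P"
  let ?S2 = "\<integral>\<^sup>+\<omega>. \<integral>\<^sup>+(x, y). ennreal ((diff_op2 x y F (\<eta> \<omega>))\<^sup>2) \<partial>(L \<Otimes>\<^sub>M L) \<partial>P"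
  let ?V = "P.variance (\<lambda>\<omega>. F (\<eta> \<omega>))"
  interpret LL: sigma_finite_measure "L \<Otimes>\<^sub>M L"
    by (intro sigma_finite_pair_measure sigma_finite)
  have nn_distr: "(\<integral>\<^sup>+\<nu>. f \<nu> \<partial>distr P ?N \<eta>) = (\<integral>\<^sup>+\<omega>. f (\<eta> \<omega>) \<partial>P)"
    if "f \<in> borel_measurable ?N" for f :: "'a measure \<Rightarrow> ennreal"
    by (rule nn_integral_distr[OF \<eta>]) (simp only: measurable_distr_eq1 that)
  have "(\<lambda>p. ennreal ((diff_op (snd p) F (fst p))\<^sup>2)) \<in> borel_measurable (?N \<Otimes>\<^sub>M L)"
    by (intro measurable_compose[OF _ measurable_ennreal] borel_measurable_power measurable_diff_op(1)[OF F])
  from nn_distr[OF L.borel_measurable_nn_integral_fst[OF this]]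
  have S1: "(\<integral>\<^sup>+\<nu>. (\<integral>\<^sup>+x. ennreal ((diff_op x F \<nu>)\<^sup>2) \<partial>L) \<partial>distr P ?N \<eta>) = ?S1"
    by simp
  have "(\<lambda>p. ennreal ((diff_op2 (fst (snd p)) (snd (snd p)) F (fst p))\<^sup>2)) \<in> borel_measurable (?N \<Otimes>\<^sub>M (L \<Otimes>\<^sub>M L))"
    by (intro measurable_compose[OF _ measurable_ennreal] borel_measurable_power measurable_diff_op(2)[OF F])
  from nn_distr[OF LL.borel_measurable_nn_integral_fst[OF this]]
  have S2: "(\<integral>\<^sup>+\<nu>. (\<integral>\<^sup>+(x, y). ennreal ((diff_op2 x y F \<nu>)\<^sup>2) \<partial>(L \<Otimes>\<^sub>M L)) \<partial>distr P ?N \<eta>) = ?S2"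
    by (simp add: split_beta')
  have V: "variance F = ?V"
    using integral_distr[OF \<eta> F] integral_distr[OF \<eta>, of "\<lambda>\<nu>. (F \<nu> - P.expectation (\<lambda>\<omega>. F (\<eta> \<omega>)))\<^sup>2"] F
    by simp
  have F2: "integrable (distr P ?N \<eta>) (\<lambda>\<nu>. (F \<nu>)\<^sup>2)"
    using assms(4) F by (subst integrable_distr_eq[OF \<eta>]) (simp_all add: borel_measurable_power)
  \<comment> \<open>The nonzero solution of 2t - t^2 = \<alpha> t^2 + t^2: once the second-order
    term \<alpha> t^2 is absorbed, the remaining coefficient t^2 is the constant claimed.\<close>
  define t where "t = 2 / (\<alpha> + 2)"
  have t: "0 \<le> t" "t \<le> 2" and t2: "t\<^sup>2 = 4 / (\<alpha> + 2)\<^sup>2"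
    using \<open>\<alpha> \<ge> 0\<close> by (auto simp: t_def power_divide field_simps)
  have "(\<alpha> + 2) * t = 2"
    unfolding t_def using \<open>\<alpha> \<ge> 0\<close> by (simp add: divide_eq_eq)
  then have "2 * t - t\<^sup>2 = ((\<alpha> + 2) * t) * t - t\<^sup>2"
    by simp
  then have coeff: "2 * t - t\<^sup>2 = t\<^sup>2 * \<alpha> + t\<^sup>2"
    by (simp add: power2_eq_square algebra_simps)
  have "ennreal (t\<^sup>2) * (ennreal \<alpha> * ?S1) + ennreal (t\<^sup>2) * ?S1 = ennreal (2 * t - t\<^sup>2) * ?S1"
    using \<open>\<alpha> \<ge> 0\<close> by (simp add: coeff ennreal_plus ennreal_mult distrib_right mult.assoc)
  also have "\<dots> \<le> ennreal ?V + ennreal (t\<^sup>2) * ?S2"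
    using variance_bound[OF F F2 t] unfolding S1 S2 V .
  also have "\<dots> \<le> ennreal ?V + ennreal (t\<^sup>2) * (ennreal \<alpha> * ?S1)"
    using assms(6) by (intro add_left_mono mult_left_mono) simp_all
  also have "\<dots> = ennreal (t\<^sup>2) * (ennreal \<alpha> * ?S1) + ennreal ?V"
    by (rule add.commute)
  finally have "ennreal (t\<^sup>2) * (ennreal \<alpha> * ?S1) + ennreal (t\<^sup>2) * ?S1 \<le>
      ennreal (t\<^sup>2) * (ennreal \<alpha> * ?S1) + ennreal ?V" .
  \<comment> \<open>Cancellation in \<open>ennreal\<close> needs a finite term; its finiteness is
    the last inequality of the assumed chain.\<close>
  moreover have "ennreal (t\<^sup>2) * (ennreal \<alpha> * ?S1) < \<infinity>"
    using assms(7) by (auto simp: ennreal_mult_less_top)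
  ultimately have "ennreal (t\<^sup>2) * ?S1 \<le> ennreal ?V"
    unfolding ennreal_add_left_cancel_le by (elim disjE) simp_all
  then show ?thesis
    by (simp only: t2)
qed

end
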